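(* Let $(P,y)$ be a locally fully faithful KZ doctrine on a 2-category $\mathscr{C}$. Call a 1-cell $L\colon\mathcal{A}\to\mathcal{B}$ of $\mathscr{C}$ admissible when $PL$ has a right adjoint, and for each admissible $L$ choose a right adjoint $\mathrm{res}_L$ of $PL$ with unit $\eta\colon \mathrm{id}_{P\mathcal{A}}\to \mathrm{res}_L\cdot PL$. Call an object $\mathcal{A}$ admissible when $\mathrm{id}_{\mathcal{A}}$ is an admissible 1-cell. For each admissible $L\colon\mathcal{A}\to\mathcal{B}$ put $R_L:=\mathrm{res}_L\cdot y_{\mathcal{B}}\colon\mathcal{B}\to P\mathcal{A}$ and let $\varphi_L\colon y_{\mathcal{A}}\to R_L\cdot L$ be the composite 2-cell $$y_{\mathcal{A}}\xrightarrow{\ \eta\cdot y_{\mathcal{A}}\ }\mathrm{res}_L\cdot PL\cdot y_{\mathcal{A}}\xrightarrow{\ \mathrm{res}_L\cdot c_{y_{\mathcal{B}}\cdot L}^{-1}\ }\mathrm{res}_L\cdot y_{\mathcal{B}}\cdot L=R_L\cdot L .$$ Then these data satisfy all of the definition and axioms of a Yoneda structure with the exception of the right ideal property (which would ask that $L\cdot F$ be admissible whenever $L$ is admissible and $L\cdot F$ is defined), though the admissible maps remain closed under composition. Explicitly: (1) the composite of two composable admissible 1-cells is admissible; (2) for each admissible object $\mathcal{A}$, the 1-cell $y_{\mathcal{A}}\colon\mathcal{A}\to P\mathcal{A}$ is admissible; (3) for each $L\colon\mathcal{A}\to\mathcal{B}$ such that $L$ and $\mathcal{A}$ are both admissible,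 $\varphi_L\colon y_{\mathcal{A}}\to R_L\cdot L$ exhibits $L$ as an absolute left lifting of $y_{\mathcal{A}}$ through $R_L$, and exhibits $R_L$ as a left extension of $y_{\mathcal{A}}$ along $L$; (4) for each admissible object $\mathcal{A}$, the identity 2-cell on $y_{\mathcal{A}}$ exhibits $\mathrm{id}_{P\mathcal{A}}$ as a left extension of $y_{\mathcal{A}}$ along $y_{\mathcal{A}}$; (5) for all admissible objects $\mathcal{A},\mathcal{B}$ and admissible 1-cells $L\colon\mathcal{A}\to\mathcal{B}$ and $K\colon\mathcal{B}\to\mathcal{C}$, the pasting $$y_{\mathcal{A}}\xrightarrow{\ \varphi_{y_{\mathcal{B}}\cdot L}\ }R_{y_{\mathcal{B}}\cdot L}\cdot y_{\mathcal{B}}\cdot L\xrightarrow{\ R_{y_{\mathcal{B}}\cdot L}\cdot\varphi_K\cdot L\ }R_{y_{\mathcal{B}}\cdot L}\cdot R_K\cdot K\cdot L$$ exhibits $R_{y_{\mathcal{B}}\cdot L}\cdot R_K$ as a left extension of $y_{\mathcal{A}}$ along $K\cdot L$.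
   Context: Left extensions. In a 2-category $\mathscr{C}$, let $L\colon\mathcal{A}\to\mathcal{B}$, $I\colon\mathcal{A}\to\mathcal{C}$, $R\colon\mathcal{B}\to\mathcal{C}$ be 1-cells and $\eta\colon I\to R\cdot L$ a 2-cell. $R$ is exhibited as a left extension of $I$ along $L$ by $\eta$ when, for every $M\colon\mathcal{B}\to\mathcal{C}$, the assignment $\sigma\mapsto(\sigma\cdot L)\circ\eta$ is a bijection between 2-cells $R\to M$ and 2-cells $I\to M\cdot L$. This left extension is respected by $E\colon\mathcal{C}\to\mathcal{D}$ when $E\cdot\eta$ exhibits $E\cdot R$ as a left extension of $E\cdot I$ along $L$. Left liftings. $\eta\colon I\to R\cdot L$ exhibits $L$ as a left lifting of $I$ through $R$ when, for every $K\colon\mathcal{A}\to\mathcal{B}$, the assignment $\delta\mapsto(R\cdot\delta)\circ\eta$ is a bijection between 2-cells $L\to K$ and 2-cells $I\to R\cdot K$. It is absolute if for every 1-cell $F\colon\mathcal{X}\to\mathcal{A}$ the whiskering $\eta\cdot F$ exhibits $L\cdot F$ as a left lifting of $I\cdot F$ through $R$. KZ doctrines. A KZ doctrine $(P,y)$ on $\mathscr{C}$ consists of: (i) an assignation on objects $P\colon\mathrm{ob}\,\mathscr{C}\to\mathrm{ob}\,\mathscr{C}$; (ii) for every object $\mathcal{A}$ a 1-cell $y_{\mathcal{A}}\colon\mathcal{A}\to P\mathcal{A}$; (iii) for every pair of objects $\mathcal{A},\mathcal{B}$ and 1-cell $F\colon\mathcal{A}\to P\mathcal{B}$, a left extension $\overline{F}\colon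 P\mathcal{A}\to P\mathcal{B}$ of $F$ along $y_{\mathcal{A}}$ exhibited by an isomorphism $c_F\colon F\to\overline{F}\cdot y_{\mathcal{A}}$; such that (a) for every $\mathcal{A}$, $\overline{y_{\mathcal{A}}}=\mathrm{id}_{P\mathcal{A}}$ with $c_{y_{\mathcal{A}}}$ the identity 2-cell; and (b) for any $G\colon\mathcal{B}\to P\mathcal{C}$, the 1-cell $\overline{G}\colon P\mathcal{B}\to P\mathcal{C}$ respects the left extension $\overline{F}$ for every $F\colon\mathcal{A}\to P\mathcal{B}$. For a 1-cell $L\colon\mathcal{A}\to\mathcal{B}$, define $PL:=\overline{y_{\mathcal{B}}\cdot L}\colon P\mathcal{A}\to P\mathcal{B}$, exhibited as a left extension by the isomorphism $c_{y_{\mathcal{B}}\cdot L}\colon y_{\mathcal{B}}\cdot L\to PL\cdot y_{\mathcal{A}}$. A KZ doctrine is locally fully faithful if every unit component $y_{\mathcal{A}}$ is fully faithful, i.e. whiskering with $y_{\mathcal{A}}$ gives, for every object $\mathcal{D}$, a fully faithful functor $\mathscr{C}(\mathcal{D},\mathcal{A})\to\mathscr{C}(\mathcal{D},P\mathcal{A})$. A Yoneda structure (Street–Walters) consists of a class of admissible 1-cells satisfying the right ideal property, admissible 1-cells $y_{\mathcal{A}}$ for admissible objects $\mathcal{A}$, and pairs $(R_L,\varphi_L)$ for admissible $L$ with admissible domain, satisfying exactly the conditions listed as (2)–(5) in the claim. *)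

theory Defs
  imports Main
begin

section \<open>Strict 2-categories\<close>

text \<open>
  Both compositions are written in applicative order: \<open>R \<cdot> L\<close> is \<open>L\<close> followed by \<open>R\<close>, and
  \<open>\<tau> \<bullet> \<sigma>\<close> is \<open>\<sigma>\<close> followed by \<open>\<tau>\<close>. All operations are total functions whose values are
  unspecified on arguments that are not composable cells of the 2-category.
\<close>

record ('o, 'm, 'c) two_cat =
  objs :: "'o set"
  cells1 :: "'m set"
  cells2 :: "'c set"
  src1 :: "'m \<Rightarrow> 'o"
  tgt1 :: "'m \<Rightarrow> 'o"
  src2 :: "'c \<Rightarrow> 'm"
  tgt2 :: "'c \<Rightarrow> 'm"
  id1 :: "'o \<Rightarrow> 'm"
  id2 :: "'m \<Rightarrow> 'c"
  comp1 :: "'m \<Rightarrow> 'm \<Rightarrow> 'm"  (infixr "\<cdot>\<index>" 75)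
  vcomp :: "'c \<Rightarrow> 'c \<Rightarrow> 'c"  (infixr "\<bullet>\<index>" 65)
  hcomp :: "'c \<Rightarrow> 'c \<Rightarrow> 'c"  (infixr "\<star>\<index>" 75)

definition hom1 :: "('o, 'm, 'c) two_cat \<Rightarrow> 'o \<Rightarrow> 'o \<Rightarrow> 'm set" where
  "hom1 C A B = {F \<in> cells1 C. src1 C F = A \<and> tgt1 C F = B}"

definition hom2 :: "('o, 'm, 'c) two_cat \<Rightarrow> 'm \<Rightarrow> 'm \<Rightarrow> 'c set" where
  "hom2 C F G = {\<sigma> \<in> cells2 C. src2 C \<sigma> = F \<and> tgt2 C \<sigma> = G}"

locale two_category =
  fixes C :: "('o, 'm, 'c) two_cat" (structure)
  assumes src1_obj: "F \<in> cells1 C \<Longrightarrow> src1 C F \<in> objs C"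
    and tgt1_obj: "F \<in> cells1 C \<Longrightarrow> tgt1 C F \<in> objs C"
    and src2_cell: "\<sigma> \<in> cells2 C \<Longrightarrow> src2 C \<sigma> \<in> cells1 C"
    and tgt2_cell: "\<sigma> \<in> cells2 C \<Longrightarrow> tgt2 C \<sigma> \<in> cells1 C"
    and src1_parallel: "\<sigma> \<in> cells2 C \<Longrightarrow> src1 C (src2 C \<sigma>) = src1 C (tgt2 C \<sigma>)"
    and tgt1_parallel: "\<sigma> \<in> cells2 C \<Longrightarrow> tgt1 C (src2 C \<sigma>) = tgt1 C (tgt2 C \<sigma>)"
    and id1_hom: "A \<in> objs C \<Longrightarrow> id1 C A \<in> hom1 C A A"
    and comp1_hom: "\<lbrakk>F \<in> hom1 C X Y; G \<in> hom1 C Y Z\<rbrakk> \<Longrightarrow> G \<cdot> F \<in> hom1 C X Z"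
    and id1_left: "F \<in> hom1 C X Y \<Longrightarrow> id1 C Y \<cdot> F = F"
    and id1_right: "F \<in> hom1 C X Y \<Longrightarrow> F \<cdot> id1 C X = F"
    and comp1_assoc: "\<lbrakk>F \<in> hom1 C W X; G \<in> hom1 C X Y; H \<in> hom1 C Y Z\<rbrakk>
      \<Longrightarrow> (H \<cdot> G) \<cdot> F = H \<cdot> (G \<cdot> F)"
    and id2_hom: "F \<in> cells1 C \<Longrightarrow> id2 C F \<in> hom2 C F F"
    and vcomp_hom: "\<lbrakk>\<sigma> \<in> hom2 C F G; \<tau> \<in> hom2 C G H\<rbrakk> \<Longrightarrow> \<tau> \<bullet> \<sigma> \<in> hom2 C F H"
    and id2_left: "\<sigma> \<in> hom2 C F G \<Longrightarrow> id2 C G \<bullet> \<sigma> = \<sigma>"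
    and id2_right: "\<sigma> \<in> hom2 C F G \<Longrightarrow> \<sigma> \<bullet> id2 C F = \<sigma>"
    and vcomp_assoc: "\<lbrakk>\<sigma> \<in> hom2 C F G; \<tau> \<in> hom2 C G H; \<upsilon> \<in> hom2 C H K\<rbrakk>
      \<Longrightarrow> (\<upsilon> \<bullet> \<tau>) \<bullet> \<sigma> = \<upsilon> \<bullet> (\<tau> \<bullet> \<sigma>)"
    and hcomp_hom: "\<lbrakk>F \<in> hom1 C X Y; G \<in> hom1 C Y Z; \<sigma> \<in> hom2 C F F'; \<tau> \<in> hom2 C G G'\<rbrakk>
      \<Longrightarrow> \<tau> \<star> \<sigma> \<in> hom2 C (G \<cdot> F) (G' \<cdot> F')"
    and hcomp_id_left: "\<lbrakk>F \<in> hom1 C X Y; \<sigma> \<in> hom2 C F F'\<rbrakk> \<Longrightarrow> id2 C (id1 C Y) \<star> \<sigma> = \<sigma>"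
    and hcomp_id_right: "\<lbrakk>F \<in> hom1 C X Y; \<sigma> \<in> hom2 C F F'\<rbrakk> \<Longrightarrow> \<sigma> \<star> id2 C (id1 C X) = \<sigma>"
    and hcomp_assoc: "\<lbrakk>F \<in> hom1 C W X; G \<in> hom1 C X Y; H \<in> hom1 C Y Z;
        \<sigma> \<in> hom2 C F F'; \<tau> \<in> hom2 C G G'; \<upsilon> \<in> hom2 C H H'\<rbrakk>
      \<Longrightarrow> (\<upsilon> \<star> \<tau>) \<star> \<sigma> = \<upsilon> \<star> (\<tau> \<star> \<sigma>)"
    and hcomp_id2: "\<lbrakk>F \<in> hom1 C X Y; G \<in> hom1 C Y Z\<rbrakk> \<Longrightarrow> id2 C G \<star> id2 C F = id2 C (G \<cdot> F)"
    and interchange: "\<lbrakk>F \<in> hom1 C X Y; G \<in> hom1 C Y Z;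
        \<sigma> \<in> hom2 C F F'; \<sigma>' \<in> hom2 C F' F''; \<tau> \<in> hom2 C G G'; \<tau>' \<in> hom2 C G' G''\<rbrakk>
      \<Longrightarrow> (\<tau>' \<bullet> \<tau>) \<star> (\<sigma>' \<bullet> \<sigma>) = (\<tau>' \<star> \<sigma>') \<bullet> (\<tau> \<star> \<sigma>)"

definition whisker_l :: "('o, 'm, 'c) two_cat \<Rightarrow> 'm \<Rightarrow> 'c \<Rightarrow> 'c"  (infixr "\<rhd>\<index>" 75) where
  "F \<rhd>\<^bsub>C\<^esub> \<sigma> = id2 C F \<star>\<^bsub>C\<^esub> \<sigma>"

definition whisker_r :: "('o, 'm, 'c) two_cat \<Rightarrow> 'c \<Rightarrow> 'm \<Rightarrow> 'c"  (infixl "\<lhd>\<index>" 75) where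
  "\<sigma> \<lhd>\<^bsub>C\<^esub> F = \<sigma> \<star>\<^bsub>C\<^esub> id2 C F"

definition inverse2 :: "('o, 'm, 'c) two_cat \<Rightarrow> 'c \<Rightarrow> 'c \<Rightarrow> bool" where
  "inverse2 C \<sigma> \<tau> \<longleftrightarrow> \<tau> \<in> hom2 C (tgt2 C \<sigma>) (src2 C \<sigma>) \<and>
     \<tau> \<bullet>\<^bsub>C\<^esub> \<sigma> = id2 C (src2 C \<sigma>) \<and> \<sigma> \<bullet>\<^bsub>C\<^esub> \<tau> = id2 C (tgt2 C \<sigma>)"

definition iso2 :: "('o, 'm, 'c) two_cat \<Rightarrow> 'c \<Rightarrow> bool" where
  "iso2 C \<sigma> \<longleftrightarrow> \<sigma> \<in> cells2 C \<and> (\<exists>\<tau>. inverse2 C \<sigma> \<tau>)"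

definition inv2 :: "('o, 'm, 'c) two_cat \<Rightarrow> 'c \<Rightarrow> 'c" where
  "inv2 C \<sigma> = (THE \<tau>. inverse2 C \<sigma> \<tau>)"

definition adjunction :: "('o, 'm, 'c) two_cat \<Rightarrow> 'm \<Rightarrow> 'm \<Rightarrow> 'c \<Rightarrow> 'c \<Rightarrow> bool" where
  "adjunction C L R \<eta> \<epsilon> \<longleftrightarrow>
     L \<in> cells1 C \<and> R \<in> hom1 C (tgt1 C L) (src1 C L) \<and>
     \<eta> \<in> hom2 C (id1 C (src1 C L)) (R \<cdot>\<^bsub>C\<^esub> L) \<and>
     \<epsilon> \<in> hom2 C (L \<cdot>\<^bsub>C\<^esub> R) (id1 C (tgt1 C L)) \<and>
     (\<epsilon> \<lhd>\<^bsub>C\<^esub> L) \<bullet>\<^bsub>C\<^esub> (L \<rhd>\<^bsub>C\<^esub> \<eta>) = id2 C L \<and>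
     (R \<rhd>\<^bsub>C\<^esub> \<epsilon>) \<bullet>\<^bsub>C\<^esub> (\<eta> \<lhd>\<^bsub>C\<^esub> R) = id2 C R"

text \<open>\<open>R\<close> is a right adjoint of \<open>L\<close> with unit \<open>\<eta>\<close>.\<close>

definition right_adjoint_unit :: "('o, 'm, 'c) two_cat \<Rightarrow> 'm \<Rightarrow> 'm \<Rightarrow> 'c \<Rightarrow> bool" where
  "right_adjoint_unit C L R \<eta> \<longleftrightarrow> (\<exists>\<epsilon>. adjunction C L R \<eta> \<epsilon>)"

definition has_right_adjoint :: "('o, 'm, 'c) two_cat \<Rightarrow> 'm \<Rightarrow> bool" where
  "has_right_adjoint C L \<longleftrightarrow> (\<exists>R \<eta>. right_adjoint_unit C L R \<eta>)"

definition fully_faithful :: "('o, 'm, 'c) two_cat \<Rightarrow> 'm \<Rightarrow> bool" where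
  "fully_faithful C F \<longleftrightarrow> F \<in> cells1 C \<and>
     (\<forall>D \<in> objs C. \<forall>G \<in> hom1 C D (src1 C F). \<forall>H \<in> hom1 C D (src1 C F).
        bij_betw (\<lambda>\<sigma>. F \<rhd>\<^bsub>C\<^esub> \<sigma>) (hom2 C G H) (hom2 C (F \<cdot>\<^bsub>C\<^esub> G) (F \<cdot>\<^bsub>C\<^esub> H)))"


section \<open>Left extensions and left liftings\<close>

text \<open>\<open>\<eta> : I \<rightarrow> R \<cdot> L\<close> exhibits \<open>R\<close> as a left extension of \<open>I\<close> along \<open>L\<close>.\<close>

definition left_extension :: "('o, 'm, 'c) two_cat \<Rightarrow> 'm \<Rightarrow> 'm \<Rightarrow> 'm \<Rightarrow> 'c \<Rightarrow> bool" where
  "left_extension C I L R \<eta> \<longleftrightarrow>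
     I \<in> cells1 C \<and> L \<in> hom1 C (src1 C I) (tgt1 C L) \<and> R \<in> hom1 C (tgt1 C L) (tgt1 C I) \<and>
     \<eta> \<in> hom2 C I (R \<cdot>\<^bsub>C\<^esub> L) \<and>
     (\<forall>M \<in> hom1 C (tgt1 C L) (tgt1 C I).
        bij_betw (\<lambda>\<sigma>. (\<sigma> \<lhd>\<^bsub>C\<^esub> L) \<bullet>\<^bsub>C\<^esub> \<eta>) (hom2 C R M) (hom2 C I (M \<cdot>\<^bsub>C\<^esub> L)))"

text \<open>\<open>E\<close> respects the left extension \<open>R\<close> of \<open>I\<close> along \<open>L\<close> exhibited by \<open>\<eta>\<close>.\<close>

definition respects_left_extension ::
  "('o, 'm, 'c) two_cat \<Rightarrow> 'm \<Rightarrow> 'm \<Rightarrow> 'm \<Rightarrow> 'm \<Rightarrow> 'c \<Rightarrow> bool" where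
  "respects_left_extension C E I L R \<eta> \<longleftrightarrow>
     left_extension C (E \<cdot>\<^bsub>C\<^esub> I) L (E \<cdot>\<^bsub>C\<^esub> R) (E \<rhd>\<^bsub>C\<^esub> \<eta>)"

text \<open>\<open>\<eta> : I \<rightarrow> R \<cdot> L\<close> exhibits \<open>L\<close> as a left lifting of \<open>I\<close> through \<open>R\<close>.\<close>

definition left_lifting :: "('o, 'm, 'c) two_cat \<Rightarrow> 'm \<Rightarrow> 'm \<Rightarrow> 'm \<Rightarrow> 'c \<Rightarrow> bool" where
  "left_lifting C I R L \<eta> \<longleftrightarrow>
     I \<in> cells1 C \<and> R \<in> hom1 C (src1 C R) (tgt1 C I) \<and> L \<in> hom1 C (src1 C I) (src1 C R) \<and>
     \<eta> \<in> hom2 C I (R \<cdot>\<^bsub>C\<^esub> L) \<and>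
     (\<forall>K \<in> hom1 C (src1 C I) (src1 C R).
        bij_betw (\<lambda>\<delta>. (R \<rhd>\<^bsub>C\<^esub> \<delta>) \<bullet>\<^bsub>C\<^esub> \<eta>) (hom2 C L K) (hom2 C I (R \<cdot>\<^bsub>C\<^esub> K)))"

definition absolute_left_lifting :: "('o, 'm, 'c) two_cat \<Rightarrow> 'm \<Rightarrow> 'm \<Rightarrow> 'm \<Rightarrow> 'c \<Rightarrow> bool" where
  "absolute_left_lifting C I R L \<eta> \<longleftrightarrow> left_lifting C I R L \<eta> \<and>
     (\<forall>X \<in> objs C. \<forall>F \<in> hom1 C X (src1 C I).
        left_lifting C (I \<cdot>\<^bsub>C\<^esub> F) R (L \<cdot>\<^bsub>C\<^esub> F) (\<eta> \<lhd>\<^bsub>C\<^esub> F))"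


section \<open>KZ doctrines\<close>

text \<open>
  For \<open>F : A \<rightarrow> P B\<close>, \<open>kz_lan K A B F : P A \<rightarrow> P B\<close> is the chosen left extension of \<open>F\<close> along the
  unit of \<open>A\<close>, exhibited by \<open>kz_lan_cell K A B F\<close>. The object \<open>B\<close> is an argument because it need not
  be determined by \<open>P B\<close>.
\<close>

record ('o, 'm, 'c) kz =
  kz_P :: "'o \<Rightarrow> 'o"
  kz_y :: "'o \<Rightarrow> 'm"
  kz_lan :: "'o \<Rightarrow> 'o \<Rightarrow> 'm \<Rightarrow> 'm"
  kz_lan_cell :: "'o \<Rightarrow> 'o \<Rightarrow> 'm \<Rightarrow> 'c"

locale kz_doctrine = two_category C
  for C :: "('o, 'm, 'c) two_cat" (structure) +
  fixes K :: "('o, 'm, 'c) kz"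
  assumes P_obj: "A \<in> objs C \<Longrightarrow> kz_P K A \<in> objs C"
    and y_hom: "A \<in> objs C \<Longrightarrow> kz_y K A \<in> hom1 C A (kz_P K A)"
    and ext_left_extension: "\<lbrakk>A \<in> objs C; B \<in> objs C; F \<in> hom1 C A (kz_P K B)\<rbrakk>
      \<Longrightarrow> left_extension C F (kz_y K A) (kz_lan K A B F) (kz_lan_cell K A B F)"
    and cell_iso: "\<lbrakk>A \<in> objs C; B \<in> objs C; F \<in> hom1 C A (kz_P K B)\<rbrakk>
      \<Longrightarrow> iso2 C (kz_lan_cell K A B F)"
    and ext_y: "A \<in> objs C \<Longrightarrow> kz_lan K A A (kz_y K A) = id1 C (kz_P K A)"
    and cell_y: "A \<in> objs C \<Longrightarrow> kz_lan_cell K A A (kz_y K A) = id2 C (kz_y K A)"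
    and ext_respects: "\<lbrakk>A \<in> objs C; B \<in> objs C; D \<in> objs C;
        F \<in> hom1 C A (kz_P K B); G \<in> hom1 C B (kz_P K D)\<rbrakk>
      \<Longrightarrow> respects_left_extension C (kz_lan K B D G)
            F (kz_y K A) (kz_lan K A B F) (kz_lan_cell K A B F)"

locale locally_fully_faithful_kz_doctrine = kz_doctrine +
  assumes y_fully_faithful: "A \<in> objs C \<Longrightarrow> fully_faithful C (kz_y K A)"

definition kz_map :: "('o, 'm, 'c) two_cat \<Rightarrow> ('o, 'm, 'c) kz \<Rightarrow> 'm \<Rightarrow> 'm" where
  "kz_map C K L = kz_lan K (src1 C L) (tgt1 C L) (kz_y K (tgt1 C L) \<cdot>\<^bsub>C\<^esub> L)"

definition kz_map_cell :: "('o, 'm, 'c) two_cat \<Rightarrow> ('o, 'm, 'c) kz \<Rightarrow> 'm \<Rightarrow> 'c" where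
  "kz_map_cell C K L = kz_lan_cell K (src1 C L) (tgt1 C L) (kz_y K (tgt1 C L) \<cdot>\<^bsub>C\<^esub> L)"

definition admissible :: "('o, 'm, 'c) two_cat \<Rightarrow> ('o, 'm, 'c) kz \<Rightarrow> 'm \<Rightarrow> bool" where
  "admissible C K L \<longleftrightarrow> L \<in> cells1 C \<and> has_right_adjoint C (kz_map C K L)"

definition admissible_obj :: "('o, 'm, 'c) two_cat \<Rightarrow> ('o, 'm, 'c) kz \<Rightarrow> 'o \<Rightarrow> bool" where
  "admissible_obj C K A \<longleftrightarrow> A \<in> objs C \<and> admissible C K (id1 C A)"

text \<open>
  In the following, \<open>res L\<close> and \<open>\<eta> L\<close> are the chosen right adjoint of \<open>P L\<close> and its unit, and
  \<open>yoneda_cell\<close> is the 2-cell \<open>y\<^sub>A \<rightarrow> res L \<cdot> P L \<cdot> y\<^sub>A \<rightarrow> res L \<cdot> y\<^sub>B \<cdot> L\<close> for \<open>L : A \<rightarrow> B\<close>.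
\<close>

definition yoneda_R ::
  "('o, 'm, 'c) two_cat \<Rightarrow> ('o, 'm, 'c) kz \<Rightarrow> ('m \<Rightarrow> 'm) \<Rightarrow> 'm \<Rightarrow> 'm" where
  "yoneda_R C K res L = res L \<cdot>\<^bsub>C\<^esub> kz_y K (tgt1 C L)"

definition yoneda_cell ::
  "('o, 'm, 'c) two_cat \<Rightarrow> ('o, 'm, 'c) kz \<Rightarrow> ('m \<Rightarrow> 'm) \<Rightarrow> ('m \<Rightarrow> 'c) \<Rightarrow> 'm \<Rightarrow> 'c" where
  "yoneda_cell C K res \<eta> L =
     (res L \<rhd>\<^bsub>C\<^esub> inv2 C (kz_map_cell C K L)) \<bullet>\<^bsub>C\<^esub> (\<eta> L \<lhd>\<^bsub>C\<^esub> kz_y K (src1 C L))"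

end

theory Submission
  imports Defs
begin

text \<open>
  Throughout, say that a 1-cell \<open>T : P A \<rightarrow> X\<close> \<^emph>\<open>extends its restriction\<close> when the identity 2-cell
  exhibits it as a left extension of \<open>T \<cdot> y\<^sub>A\<close> along \<open>y\<^sub>A\<close>, so that 2-cells \<open>T \<rightarrow> N\<close>, for any
  \<open>N : P A \<rightarrow> X\<close>, are the same as 2-cells \<open>T \<cdot> y\<^sub>A \<rightarrow> N \<cdot> y\<^sub>A\<close>. In the motivating
  example, where \<open>P\<close> is the presheaf construction, these are the cocontinuous functors.
  Every extension \<open>kz_lan\<close> has the property, and it is stable under isomorphism and, because extensions respect extensions, under composition. A 1-cell with the property
  is determined up to isomorphism by its restriction, which gives \<open>P (M \<cdot> L) \<cong> P M \<cdot> P L\<close> and hence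
  closure of admissible 1-cells under composition. The same principle produces the adjunction between
  \<open>P y\<^sub>A\<close> and the extension of \<open>id\<close> along \<open>y\<^bsub>PA\<^esub>\<close>, so units are admissible.

  The key point is that a right adjoint \<open>res\<^sub>L\<close> of \<open>P L\<close> extends its restriction
  (\<open>res_extends_restriction\<close>). Precomposition with the adjunction shows that
  \<open>res\<^sub>L\<close> is a left extension of \<open>y\<^sub>A\<close> along \<open>y\<^sub>B \<cdot> L\<close>, exhibited by \<open>\<phi>\<^sub>L\<close>. Let \<open>S\<close> be the chosen
  extension of \<open>res\<^sub>L \<cdot> y\<^sub>B\<close>. The universal property of \<open>S\<close> gives \<open>\<kappa> : S \<rightarrow> res\<^sub>L\<close>, that of
  \<open>res\<^sub>L\<close> gives \<open>\<mu> : res\<^sub>L \<rightarrow> S\<close>, and \<open>\<kappa> \<bullet> \<mu> = id\<close>. Since \<open>\<kappa>\<close> is invertible after restriction to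
  \<open>B\<close>, so is \<open>\<mu>\<close>, with the inverse value, and therefore \<open>\<mu> \<bullet> \<kappa> = id\<close> too.

  Left extensions along \<open>L\<close> follow: if \<open>T : P B \<rightarrow> P E\<close> extends its restriction, then a left extension
  \<open>T\<close> of \<open>I\<close> along \<open>y\<^sub>B \<cdot> L\<close> restricts to a left extension \<open>T \<cdot> y\<^sub>B\<close> of \<open>I\<close> along \<open>L\<close>
  (\<open>left_extension_restrict_unit\<close>). With \<open>T = res\<^sub>L\<close> this is the extension property of \<open>R\<^sub>L\<close>. The absolute
  lifting property is transposition across the adjunction between \<open>P L\<close> and \<open>res\<^sub>L\<close>
  combined with full faithfulness of \<open>y\<^sub>B\<close>.

  For the pasting, put \<open>Q = yoneda_R (y\<^sub>B \<cdot> L)\<close>. Both \<open>Q\<close> and \<open>res\<^sub>L\<close> are left extensions of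
  \<open>y\<^sub>A\<close> along \<open>y\<^sub>B \<cdot> L\<close>, hence isomorphic, so \<open>Q\<close> extends its restriction. It follows
  that \<open>Q \<cdot> y\<^sub>B\<close> is a left extension of \<open>y\<^sub>A\<close> along \<open>L\<close>, and that \<open>Q\<close> respects the left extension
  \<open>R\<^sub>M\<close> of \<open>y\<^sub>B\<close> along \<open>M\<close>. The two left extensions paste.
\<close>

section \<open>Normalising pastings of 2-cells\<close>

lemma bij_betw_replace:
  assumes "bij_betw f A B" "\<And>a. a \<in> A \<Longrightarrow> f a = g a" "B = B'"
  shows "bij_betw g A B'"
  using assms bij_betw_cong[of A f g B] by simp

context two_category
begin

text \<open>
  The locale axioms name the objects at the ends of every 1-cell. Unfolding membership in hom-sets into
  equations for sources and targets turns all typing conditions into rewriting problems, so that in the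
  following rules the simplifier finds the intermediate cells by itself.
\<close>

lemma in_hom1: "F \<in> hom1 C X Y \<longleftrightarrow> F \<in> cells1 C \<and> src1 C F = X \<and> tgt1 C F = Y"
  by (auto simp: hom1_def)

lemma in_hom2: "\<sigma> \<in> hom2 C F G \<longleftrightarrow> \<sigma> \<in> cells2 C \<and> src2 C \<sigma> = F \<and> tgt2 C \<sigma> = G"
  by (auto simp: hom2_def)

lemma hom1_self: "F \<in> cells1 C \<Longrightarrow> F \<in> hom1 C (src1 C F) (tgt1 C F)"
  by (simp add: in_hom1)

declare src1_parallel [symmetric, simp] tgt1_parallel [symmetric, simp]
declare src1_obj [simp] tgt1_obj [simp] src2_cell [simp] tgt2_cell [simp]

lemma id1_simps [simp]:
  assumes "A \<in> objs C"
  shows "id1 C A \<in> cells1 C" "src1 C (id1 C A) = A" "tgt1 C (id1 C A) = A"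
  using id1_hom[OF assms] by (auto simp: in_hom1)

lemma comp1_simps [simp]:
  assumes "F \<in> cells1 C" "G \<in> cells1 C" "src1 C G = tgt1 C F"
  shows "G \<cdot> F \<in> cells1 C" "src1 C (G \<cdot> F) = src1 C F" "tgt1 C (G \<cdot> F) = tgt1 C G"
  using comp1_hom[of F "src1 C F" "tgt1 C F" G "tgt1 C G"] assms by (auto simp: in_hom1)

lemma comp1_id_simps [simp]:
  assumes "F \<in> cells1 C"
  shows "tgt1 C F = Y \<Longrightarrow> id1 C Y \<cdot> F = F" "src1 C F = X \<Longrightarrow> F \<cdot> id1 C X = F"
  using id1_left id1_right assms by (auto simp: in_hom1)

lemma comp1_assoc' [simp]:
  assumes "F \<in> cells1 C" "G \<in> cells1 C" "H \<in> cells1 C" "src1 C G = tgt1 C F" "src1 C H = tgt1 C G"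
  shows "(H \<cdot> G) \<cdot> F = H \<cdot> (G \<cdot> F)"
  using comp1_assoc[of F "src1 C F" "tgt1 C F" G "tgt1 C G" H "tgt1 C H"] assms
  by (auto simp: in_hom1)

lemma id2_simps [simp]:
  assumes "F \<in> cells1 C"
  shows "id2 C F \<in> cells2 C" "src2 C (id2 C F) = F" "tgt2 C (id2 C F) = F"
  using id2_hom[OF assms] by (auto simp: in_hom2)

lemma vcomp_simps [simp]:
  assumes "\<sigma> \<in> cells2 C" "\<tau> \<in> cells2 C" "src2 C \<tau> = tgt2 C \<sigma>"
  shows "\<tau> \<bullet> \<sigma> \<in> cells2 C" "src2 C (\<tau> \<bullet> \<sigma>) = src2 C \<sigma>" "tgt2 C (\<tau> \<bullet> \<sigma>) = tgt2 C \<tau>"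
  using vcomp_hom[of \<sigma> "src2 C \<sigma>" "tgt2 C \<sigma>" \<tau> "tgt2 C \<tau>"] assms by (auto simp: in_hom2)

lemma vcomp_id_simps [simp]:
  assumes "\<sigma> \<in> cells2 C"
  shows "tgt2 C \<sigma> = G \<Longrightarrow> id2 C G \<bullet> \<sigma> = \<sigma>" "src2 C \<sigma> = F \<Longrightarrow> \<sigma> \<bullet> id2 C F = \<sigma>"
  using id2_left id2_right assms by (auto simp: in_hom2)

lemma vcomp_assoc' [simp]:
  assumes "\<sigma> \<in> cells2 C" "\<tau> \<in> cells2 C" "\<upsilon> \<in> cells2 C" "src2 C \<tau> = tgt2 C \<sigma>" "src2 C \<upsilon> = tgt2 C \<tau>"
  shows "(\<upsilon> \<bullet> \<tau>) \<bullet> \<sigma> = \<upsilon> \<bullet> (\<tau> \<bullet> \<sigma>)"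
  using vcomp_assoc[of \<sigma> "src2 C \<sigma>" "tgt2 C \<sigma>" \<tau> "tgt2 C \<tau>" \<upsilon> "tgt2 C \<upsilon>"] assms
  by (auto simp: in_hom2)

text \<open>
  Vertical composites are normalised to the right, so an equation for \<open>\<tau> \<bullet> \<sigma>\<close> does not apply
  inside a longer composite; this is its form for use there.
\<close>

lemma vcomp_reassoc:
  assumes "\<tau> \<bullet> \<sigma> = \<upsilon>" "\<rho> \<in> cells2 C" "\<sigma> \<in> cells2 C" "\<tau> \<in> cells2 C"
    "src2 C \<sigma> = tgt2 C \<rho>" "src2 C \<tau> = tgt2 C \<sigma>"
  shows "\<tau> \<bullet> (\<sigma> \<bullet> \<rho>) = \<upsilon> \<bullet> \<rho>"
  using vcomp_assoc'[of \<rho> \<sigma> \<tau>] assms by simp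

lemma whisker_l_simps [simp]:
  assumes "\<sigma> \<in> cells2 C" "F \<in> cells1 C" "src1 C F = tgt1 C (src2 C \<sigma>)"
  shows "F \<rhd> \<sigma> \<in> cells2 C" "src2 C (F \<rhd> \<sigma>) = F \<cdot> src2 C \<sigma>" "tgt2 C (F \<rhd> \<sigma>) = F \<cdot> tgt2 C \<sigma>"
  using hcomp_hom[of "src2 C \<sigma>" "src1 C (src2 C \<sigma>)" "src1 C F" F "tgt1 C F" \<sigma> "tgt2 C \<sigma>" "id2 C F" F] assms
  unfolding whisker_l_def by (auto simp: in_hom1 in_hom2)

lemma whisker_r_simps [simp]:
  assumes "\<sigma> \<in> cells2 C" "F \<in> cells1 C" "tgt1 C F = src1 C (src2 C \<sigma>)"
  shows "\<sigma> \<lhd> F \<in> cells2 C" "src2 C (\<sigma> \<lhd> F) = src2 C \<sigma> \<cdot> F" "tgt2 C (\<sigma> \<lhd> F) = tgt2 C \<sigma> \<cdot> F"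
  using hcomp_hom[of F "src1 C F" "tgt1 C F" "src2 C \<sigma>" "tgt1 C (src2 C \<sigma>)" "id2 C F" F \<sigma> "tgt2 C \<sigma>"] assms
  unfolding whisker_r_def by (auto simp: in_hom1 in_hom2)

text \<open>
  Together with the typing rules, the rules for whiskering bring every pasting to a normal form: a
  vertical composite of generating 2-cells, each whiskered once on either side by a composite 1-cell.
  What remains after normalisation is only the interchange law, which has no preferred direction and is
  applied by hand as \<open>whisker_exchange\<close>.
\<close>

lemma whisker_l_id1 [simp]:
  assumes "\<sigma> \<in> cells2 C" "tgt1 C (src2 C \<sigma>) = Y"
  shows "id1 C Y \<rhd> \<sigma> = \<sigma>"
  using hcomp_id_left[of "src2 C \<sigma>" "src1 C (src2 C \<sigma>)" Y \<sigma> "tgt2 C \<sigma>"] assms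
  unfolding whisker_l_def by (auto simp: in_hom1 in_hom2)

lemma whisker_r_id1 [simp]:
  assumes "\<sigma> \<in> cells2 C" "src1 C (src2 C \<sigma>) = X"
  shows "\<sigma> \<lhd> id1 C X = \<sigma>"
  using hcomp_id_right[of "src2 C \<sigma>" X "tgt1 C (src2 C \<sigma>)" \<sigma> "tgt2 C \<sigma>"] assms
  unfolding whisker_r_def by (auto simp: in_hom1 in_hom2)

lemma whisker_id2 [simp]:
  assumes "F \<in> cells1 C" "G \<in> cells1 C" "src1 C G = tgt1 C F"
  shows "G \<rhd> id2 C F = id2 C (G \<cdot> F)" "id2 C G \<lhd> F = id2 C (G \<cdot> F)"
  using hcomp_id2[of F "src1 C F" "tgt1 C F" G "tgt1 C G"] assms
  unfolding whisker_l_def whisker_r_def by (auto simp: in_hom1 in_hom2)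

lemma whisker_l_comp1 [simp]:
  assumes "\<sigma> \<in> cells2 C" "F \<in> cells1 C" "G \<in> cells1 C"
    "src1 C F = tgt1 C (src2 C \<sigma>)" "src1 C G = tgt1 C F"
  shows "G \<rhd> (F \<rhd> \<sigma>) = (G \<cdot> F) \<rhd> \<sigma>"
  using hcomp_assoc[of "src2 C \<sigma>" "src1 C (src2 C \<sigma>)" "src1 C F" F "tgt1 C F" G "tgt1 C G"
      \<sigma> "tgt2 C \<sigma>" "id2 C F" F "id2 C G" G]
    hcomp_id2[of F "src1 C F" "tgt1 C F" G "tgt1 C G"] assms
  unfolding whisker_l_def by (auto simp: in_hom1 in_hom2)

lemma whisker_r_comp1 [simp]:
  assumes "\<sigma> \<in> cells2 C" "F \<in> cells1 C" "G \<in> cells1 C"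
    "tgt1 C G = src1 C (src2 C \<sigma>)" "src1 C G = tgt1 C F"
  shows "(\<sigma> \<lhd> G) \<lhd> F = \<sigma> \<lhd> (G \<cdot> F)"
  using hcomp_assoc[of F "src1 C F" "tgt1 C F" G "tgt1 C G" "src2 C \<sigma>" "tgt1 C (src2 C \<sigma>)"
      "id2 C F" F "id2 C G" G \<sigma> "tgt2 C \<sigma>"]
    hcomp_id2[of F "src1 C F" "tgt1 C F" G "tgt1 C G"] assms
  unfolding whisker_r_def by (auto simp: in_hom1 in_hom2)

lemma whisker_lr [simp]:
  assumes "\<sigma> \<in> cells2 C" "F \<in> cells1 C" "G \<in> cells1 C"
    "tgt1 C F = src1 C (src2 C \<sigma>)" "src1 C G = tgt1 C (src2 C \<sigma>)"
  shows "(G \<rhd> \<sigma>) \<lhd> F = G \<rhd> (\<sigma> \<lhd> F)"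
  using hcomp_assoc[of F "src1 C F" "tgt1 C F" "src2 C \<sigma>" "tgt1 C (src2 C \<sigma>)" G "tgt1 C G"
      "id2 C F" F \<sigma> "tgt2 C \<sigma>" "id2 C G" G] assms
  unfolding whisker_r_def whisker_l_def by (auto simp: in_hom1 in_hom2)

lemma whisker_l_vcomp [simp]:
  assumes "\<sigma> \<in> cells2 C" "\<tau> \<in> cells2 C" "F \<in> cells1 C"
    "src2 C \<tau> = tgt2 C \<sigma>" "src1 C F = tgt1 C (src2 C \<sigma>)"
  shows "F \<rhd> (\<tau> \<bullet> \<sigma>) = (F \<rhd> \<tau>) \<bullet> (F \<rhd> \<sigma>)"
  using interchange[of "src2 C \<sigma>" "src1 C (src2 C \<sigma>)" "src1 C F" F "tgt1 C F" \<sigma> "tgt2 C \<sigma>"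
      \<tau> "tgt2 C \<tau>" "id2 C F" F "id2 C F" F] assms
  unfolding whisker_l_def by (auto simp: in_hom1 in_hom2)

lemma whisker_r_vcomp [simp]:
  assumes "\<sigma> \<in> cells2 C" "\<tau> \<in> cells2 C" "F \<in> cells1 C"
    "src2 C \<tau> = tgt2 C \<sigma>" "tgt1 C F = src1 C (src2 C \<sigma>)"
  shows "(\<tau> \<bullet> \<sigma>) \<lhd> F = (\<tau> \<lhd> F) \<bullet> (\<sigma> \<lhd> F)"
  using interchange[of F "src1 C F" "tgt1 C F" "src2 C \<sigma>" "tgt1 C (src2 C \<sigma>)" "id2 C F" F
      "id2 C F" F \<sigma> "tgt2 C \<sigma>" \<tau> "tgt2 C \<tau>"] assms
  unfolding whisker_r_def by (auto simp: in_hom1 in_hom2)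

lemma whisker_exchange:
  assumes "\<sigma> \<in> hom2 C F F'" "\<tau> \<in> hom2 C G G'" "src1 C G = tgt1 C F"
  shows "(\<tau> \<lhd> F') \<bullet> (G \<rhd> \<sigma>) = (G' \<rhd> \<sigma>) \<bullet> (\<tau> \<lhd> F)"
proof -
  have c: "F \<in> hom1 C (src1 C F) (tgt1 C F)" "G \<in> hom1 C (tgt1 C F) (tgt1 C G)"
    "id2 C F \<in> hom2 C F F" "id2 C F' \<in> hom2 C F' F'" "id2 C G \<in> hom2 C G G" "id2 C G' \<in> hom2 C G' G'"
    using assms by (auto simp: in_hom1 in_hom2)
  show ?thesis
    using interchange[OF c(1,2) assms(1) c(4) c(5) assms(2)]
      interchange[OF c(1,2) c(3) assms(1) assms(2) c(6)] assms
    by (auto simp: whisker_l_def whisker_r_def in_hom2)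
qed

lemma hom2_parallel:
  assumes "\<sigma> \<in> hom2 C F G" "F \<in> hom1 C X Y"
  shows "G \<in> hom1 C X Y"
  using assms by (auto simp: in_hom1 in_hom2)

section \<open>Invertible 2-cells\<close>

lemma iso2I:
  assumes "\<alpha> \<in> hom2 C F G" "\<beta> \<in> hom2 C G F" "\<beta> \<bullet> \<alpha> = id2 C F" "\<alpha> \<bullet> \<beta> = id2 C G"
  shows "iso2 C \<alpha>"
  using assms by (auto simp: iso2_def inverse2_def in_hom2)

lemma inverse2_unique:
  assumes "\<alpha> \<in> cells2 C" "inverse2 C \<alpha> \<beta>" "inverse2 C \<alpha> \<gamma>"
  shows "\<beta> = \<gamma>"
proof -
  have "(\<beta> \<bullet> \<alpha>) \<bullet> \<gamma> = \<beta> \<bullet> (\<alpha> \<bullet> \<gamma>)"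
    using assms by (intro vcomp_assoc') (simp_all add: inverse2_def in_hom2)
  moreover have "(\<beta> \<bullet> \<alpha>) \<bullet> \<gamma> = \<gamma>" "\<beta> \<bullet> (\<alpha> \<bullet> \<gamma>) = \<beta>"
    using assms by (simp_all add: inverse2_def in_hom2 del: vcomp_assoc')
  ultimately show ?thesis by simp
qed

lemma inv2:
  assumes "iso2 C \<alpha>" "\<alpha> \<in> hom2 C F G"
  shows "inv2 C \<alpha> \<in> hom2 C G F" "inv2 C \<alpha> \<bullet> \<alpha> = id2 C F" "\<alpha> \<bullet> inv2 C \<alpha> = id2 C G"
proof -
  obtain \<beta> where \<beta>: "inverse2 C \<alpha> \<beta>" and \<alpha>: "\<alpha> \<in> cells2 C"
    using assms(1) by (auto simp: iso2_def)
  have "inv2 C \<alpha> = \<beta>"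
    unfolding inv2_def using \<beta> inverse2_unique[OF \<alpha>] by (intro the_equality) auto
  then show "inv2 C \<alpha> \<in> hom2 C G F" "inv2 C \<alpha> \<bullet> \<alpha> = id2 C F" "\<alpha> \<bullet> inv2 C \<alpha> = id2 C G"
    using \<beta> assms(2) by (auto simp: inverse2_def in_hom2)
qed

lemma iso2_inverse:
  assumes "iso2 C \<alpha>" "\<alpha> \<in> hom2 C F G"
  shows "iso2 C (inv2 C \<alpha>)"
  using inv2[OF assms] assms(2) by (intro iso2I)

lemma iso2_vcomp:
  assumes "iso2 C \<alpha>" "\<alpha> \<in> hom2 C F G" "iso2 C \<beta>" "\<beta> \<in> hom2 C G H"
  shows "iso2 C (\<beta> \<bullet> \<alpha>)"
proof -
  note i = inv2[OF assms(1,2)] inv2[OF assms(3,4)]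
  have t: "\<beta> \<bullet> (\<alpha> \<bullet> (inv2 C \<alpha> \<bullet> inv2 C \<beta>)) = id2 C H"
    "inv2 C \<alpha> \<bullet> (inv2 C \<beta> \<bullet> (\<beta> \<bullet> \<alpha>)) = id2 C F"
    using i assms by (auto simp: in_hom2 vcomp_reassoc[OF i(3)] vcomp_reassoc[OF i(5)])
  show ?thesis
    using t i assms by (intro iso2I[of _ F H "inv2 C \<alpha> \<bullet> inv2 C \<beta>"]) (auto simp: in_hom2)
qed

lemma iso2_whisker_l:
  assumes "iso2 C \<alpha>" "\<alpha> \<in> hom2 C F G" "F \<in> hom1 C X Y" "E \<in> hom1 C Y Z"
  shows "iso2 C (E \<rhd> \<alpha>)"
proof -
  note i = inv2[OF assms(1,2)]
  have "G \<in> hom1 C X Y" using hom2_parallel assms by blast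
  then show ?thesis
    using i assms whisker_l_vcomp[of \<alpha> "inv2 C \<alpha>" E] whisker_l_vcomp[of "inv2 C \<alpha>" \<alpha> E]
    by (intro iso2I[of _ "E \<cdot> F" "E \<cdot> G" "E \<rhd> inv2 C \<alpha>"]) (auto simp: in_hom2 in_hom1)
qed

lemma iso2_whisker_r:
  assumes "iso2 C \<alpha>" "\<alpha> \<in> hom2 C F G" "F \<in> hom1 C Y Z" "E \<in> hom1 C X Y"
  shows "iso2 C (\<alpha> \<lhd> E)"
proof -
  note i = inv2[OF assms(1,2)]
  have "G \<in> hom1 C Y Z" using hom2_parallel assms by blast
  then show ?thesis
    using i assms whisker_r_vcomp[of \<alpha> "inv2 C \<alpha>" E] whisker_r_vcomp[of "inv2 C \<alpha>" \<alpha> E]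
    by (intro iso2I[of _ "F \<cdot> E" "G \<cdot> E" "inv2 C \<alpha> \<lhd> E"]) (auto simp: in_hom2 in_hom1)
qed

lemma bij_postcomp_iso2:
  assumes "iso2 C \<alpha>" "\<alpha> \<in> hom2 C M N"
  shows "bij_betw (\<lambda>\<sigma>. \<alpha> \<bullet> \<sigma>) (hom2 C F M) (hom2 C F N)"
proof -
  note i = inv2[OF assms]
  show ?thesis
    using i assms by (intro bij_betw_byWitness[where f' = "\<lambda>\<sigma>. inv2 C \<alpha> \<bullet> \<sigma>"])
      (auto simp: in_hom2 vcomp_reassoc[OF i(2)] vcomp_reassoc[OF i(3)])
qed

lemma bij_precomp_iso2:
  assumes "iso2 C \<alpha>" "\<alpha> \<in> hom2 C F G"
  shows "bij_betw (\<lambda>\<sigma>. \<sigma> \<bullet> \<alpha>) (hom2 C G M) (hom2 C F M)"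
proof -
  note i = inv2[OF assms]
  show ?thesis
    using i assms by (intro bij_betw_byWitness[where f' = "\<lambda>\<sigma>. \<sigma> \<bullet> inv2 C \<alpha>"])
      (auto simp: in_hom2)
qed

section \<open>Adjunctions\<close>

lemma adjunctionE:
  assumes "adjunction C L R \<eta> \<epsilon>" "L \<in> hom1 C A B"
  obtains "R \<in> hom1 C B A" "\<eta> \<in> hom2 C (id1 C A) (R \<cdot> L)" "\<epsilon> \<in> hom2 C (L \<cdot> R) (id1 C B)"
    "(\<epsilon> \<lhd> L) \<bullet> (L \<rhd> \<eta>) = id2 C L" "(R \<rhd> \<epsilon>) \<bullet> (\<eta> \<lhd> R) = id2 C R"
  using assms by (auto simp: adjunction_def in_hom1)

lemma adjunctionI:
  assumes "L \<in> hom1 C A B" "R \<in> hom1 C B A" "\<eta> \<in> hom2 C (id1 C A) (R \<cdot> L)"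
    "\<epsilon> \<in> hom2 C (L \<cdot> R) (id1 C B)"
    "(\<epsilon> \<lhd> L) \<bullet> (L \<rhd> \<eta>) = id2 C L" "(R \<rhd> \<epsilon>) \<bullet> (\<eta> \<lhd> R) = id2 C R"
  shows "adjunction C L R \<eta> \<epsilon>"
  using assms by (auto simp: adjunction_def in_hom1)

text \<open>
  Each round trip reduces, after one interchange, to a whiskered triangle identity.
\<close>

lemma bij_transpose_postcomp:
  assumes "adjunction C L R \<eta> \<epsilon>" "L \<in> hom1 C A B" "G \<in> hom1 C X A" "H \<in> hom1 C X B"
  shows "bij_betw (\<lambda>\<delta>. (R \<rhd> \<delta>) \<bullet> (\<eta> \<lhd> G)) (hom2 C (L \<cdot> G) H) (hom2 C G (R \<cdot> H))"
proof -
  from assms(1,2) show ?thesis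
  proof (rule adjunctionE)
    assume R: "R \<in> hom1 C B A" and \<eta>: "\<eta> \<in> hom2 C (id1 C A) (R \<cdot> L)"
      and \<epsilon>: "\<epsilon> \<in> hom2 C (L \<cdot> R) (id1 C B)"
      and t1: "(\<epsilon> \<lhd> L) \<bullet> (L \<rhd> \<eta>) = id2 C L" and t2: "(R \<rhd> \<epsilon>) \<bullet> (\<eta> \<lhd> R) = id2 C R"
    have ob: "A \<in> objs C" "B \<in> objs C" using assms(2) by (auto simp: in_hom1)
    note ty = assms(2-) R \<eta> \<epsilon> ob
    have t1': "(\<epsilon> \<lhd> (L \<cdot> G)) \<bullet> (L \<rhd> (\<eta> \<lhd> G)) = id2 C (L \<cdot> G)"
      using arg_cong[OF t1, of "\<lambda>x. x \<lhd> G"] ty by (simp add: in_hom1 in_hom2)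
    have t2': "(R \<rhd> (\<epsilon> \<lhd> H)) \<bullet> (\<eta> \<lhd> (R \<cdot> H)) = id2 C (R \<cdot> H)"
      using arg_cong[OF t2, of "\<lambda>x. x \<lhd> H"] ty by (simp add: in_hom1 in_hom2)
    show ?thesis
    proof (rule bij_betw_byWitness[where f' = "\<lambda>\<sigma>. (\<epsilon> \<lhd> H) \<bullet> (L \<rhd> \<sigma>)"])
      show "\<forall>\<delta>\<in>hom2 C (L \<cdot> G) H. (\<epsilon> \<lhd> H) \<bullet> (L \<rhd> ((R \<rhd> \<delta>) \<bullet> (\<eta> \<lhd> G))) = \<delta>"
      proof
        fix \<delta> assume d: "\<delta> \<in> hom2 C (L \<cdot> G) H"
        have e: "(\<epsilon> \<lhd> H) \<bullet> ((L \<cdot> R) \<rhd> \<delta>) = \<delta> \<bullet> (\<epsilon> \<lhd> (L \<cdot> G))"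
          using whisker_exchange[OF d \<epsilon>] ty d by (simp add: in_hom1 in_hom2)
        show "(\<epsilon> \<lhd> H) \<bullet> (L \<rhd> ((R \<rhd> \<delta>) \<bullet> (\<eta> \<lhd> G))) = \<delta>"
          using ty d by (simp add: in_hom1 in_hom2 vcomp_reassoc[OF e] t1')
      qed
      show "\<forall>\<sigma>\<in>hom2 C G (R \<cdot> H). (R \<rhd> ((\<epsilon> \<lhd> H) \<bullet> (L \<rhd> \<sigma>))) \<bullet> (\<eta> \<lhd> G) = \<sigma>"
      proof
        fix \<sigma> assume s: "\<sigma> \<in> hom2 C G (R \<cdot> H)"
        have e: "((R \<cdot> L) \<rhd> \<sigma>) \<bullet> (\<eta> \<lhd> G) = (\<eta> \<lhd> (R \<cdot> H)) \<bullet> \<sigma>"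
          using whisker_exchange[OF s \<eta>] ty s by (simp add: in_hom1 in_hom2)
        show "(R \<rhd> ((\<epsilon> \<lhd> H) \<bullet> (L \<rhd> \<sigma>))) \<bullet> (\<eta> \<lhd> G) = \<sigma>"
          using ty s by (simp add: in_hom1 in_hom2 e vcomp_reassoc[OF t2'])
      qed
    qed (use ty in \<open>auto simp: in_hom1 in_hom2\<close>)
  qed
qed

text \<open>
  Precomposition with \<open>R\<close> is left adjoint to precomposition with \<open>L\<close>: the adjunction acts
  contravariantly on 1-cells out of its objects.
\<close>

lemma bij_transpose_precomp:
  assumes "adjunction C L R \<eta> \<epsilon>" "L \<in> hom1 C A B" "Q \<in> hom1 C A Z" "N \<in> hom1 C B Z"
  shows "bij_betw (\<lambda>\<sigma>. (\<sigma> \<lhd> L) \<bullet> (Q \<rhd> \<eta>)) (hom2 C (Q \<cdot> R) N) (hom2 C Q (N \<cdot> L))"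
proof -
  from assms(1,2) show ?thesis
  proof (rule adjunctionE)
    assume R: "R \<in> hom1 C B A" and \<eta>: "\<eta> \<in> hom2 C (id1 C A) (R \<cdot> L)"
      and \<epsilon>: "\<epsilon> \<in> hom2 C (L \<cdot> R) (id1 C B)"
      and t1: "(\<epsilon> \<lhd> L) \<bullet> (L \<rhd> \<eta>) = id2 C L" and t2: "(R \<rhd> \<epsilon>) \<bullet> (\<eta> \<lhd> R) = id2 C R"
    have ob: "A \<in> objs C" "B \<in> objs C" using assms(2) by (auto simp: in_hom1)
    note ty = assms(2-) R \<eta> \<epsilon> ob
    have t1': "(N \<rhd> (\<epsilon> \<lhd> L)) \<bullet> ((N \<cdot> L) \<rhd> \<eta>) = id2 C (N \<cdot> L)"
      using arg_cong[OF t1, of "\<lambda>x. N \<rhd> x"] ty by (simp add: in_hom1 in_hom2)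
    have t2': "((Q \<cdot> R) \<rhd> \<epsilon>) \<bullet> (Q \<rhd> (\<eta> \<lhd> R)) = id2 C (Q \<cdot> R)"
      using arg_cong[OF t2, of "\<lambda>x. Q \<rhd> x"] ty by (simp add: in_hom1 in_hom2)
    show ?thesis
    proof (rule bij_betw_byWitness[where f' = "\<lambda>\<sigma>. (N \<rhd> \<epsilon>) \<bullet> (\<sigma> \<lhd> R)"])
      show "\<forall>\<sigma>\<in>hom2 C (Q \<cdot> R) N. (N \<rhd> \<epsilon>) \<bullet> (((\<sigma> \<lhd> L) \<bullet> (Q \<rhd> \<eta>)) \<lhd> R) = \<sigma>"
      proof
        fix \<sigma> assume s: "\<sigma> \<in> hom2 C (Q \<cdot> R) N"
        have e: "(N \<rhd> \<epsilon>) \<bullet> (\<sigma> \<lhd> (L \<cdot> R)) = \<sigma> \<bullet> ((Q \<cdot> R) \<rhd> \<epsilon>)"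
          using whisker_exchange[OF \<epsilon> s] ty s by (simp add: in_hom1 in_hom2)
        show "(N \<rhd> \<epsilon>) \<bullet> (((\<sigma> \<lhd> L) \<bullet> (Q \<rhd> \<eta>)) \<lhd> R) = \<sigma>"
          using ty s by (simp add: in_hom1 in_hom2 vcomp_reassoc[OF e] t2')
      qed
      show "\<forall>\<sigma>\<in>hom2 C Q (N \<cdot> L). (((N \<rhd> \<epsilon>) \<bullet> (\<sigma> \<lhd> R)) \<lhd> L) \<bullet> (Q \<rhd> \<eta>) = \<sigma>"
      proof
        fix \<sigma> assume s: "\<sigma> \<in> hom2 C Q (N \<cdot> L)"
        have e: "(\<sigma> \<lhd> (R \<cdot> L)) \<bullet> (Q \<rhd> \<eta>) = ((N \<cdot> L) \<rhd> \<eta>) \<bullet> \<sigma>"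
          using whisker_exchange[OF \<eta> s] ty s by (simp add: in_hom1 in_hom2)
        show "(((N \<rhd> \<epsilon>) \<bullet> (\<sigma> \<lhd> R)) \<lhd> L) \<bullet> (Q \<rhd> \<eta>) = \<sigma>"
          using ty s by (simp add: in_hom1 in_hom2 e vcomp_reassoc[OF t1'])
      qed
    qed (use ty in \<open>auto simp: in_hom1 in_hom2\<close>)
  qed
qed

lemma adjunction_comp:
  assumes "adjunction C L R \<eta> \<epsilon>" "L \<in> hom1 C A B" "adjunction C L' R' \<eta>' \<epsilon>'" "L' \<in> hom1 C B D"
  shows "adjunction C (L' \<cdot> L) (R \<cdot> R') ((R \<rhd> (\<eta>' \<lhd> L)) \<bullet> \<eta>) (\<epsilon>' \<bullet> (L' \<rhd> (\<epsilon> \<lhd> R')))"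
proof -
  obtain ty1: "R \<in> hom1 C B A" "\<eta> \<in> hom2 C (id1 C A) (R \<cdot> L)" "\<epsilon> \<in> hom2 C (L \<cdot> R) (id1 C B)"
    and t: "(\<epsilon> \<lhd> L) \<bullet> (L \<rhd> \<eta>) = id2 C L" "(R \<rhd> \<epsilon>) \<bullet> (\<eta> \<lhd> R) = id2 C R"
    using adjunctionE[OF assms(1,2)] by blast
  obtain ty2: "R' \<in> hom1 C D B" "\<eta>' \<in> hom2 C (id1 C B) (R' \<cdot> L')" "\<epsilon>' \<in> hom2 C (L' \<cdot> R') (id1 C D)"
    and t': "(\<epsilon>' \<lhd> L') \<bullet> (L' \<rhd> \<eta>') = id2 C L'" "(R' \<rhd> \<epsilon>') \<bullet> (\<eta>' \<lhd> R') = id2 C R'"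
    using adjunctionE[OF assms(3,4)] by blast
  have ob: "A \<in> objs C" "B \<in> objs C" "D \<in> objs C" using assms by (auto simp: in_hom1)
  note ty = ob ty1 ty2 assms(2,4)
  have x: "(\<epsilon> \<lhd> (R' \<cdot> L')) \<bullet> ((L \<cdot> R) \<rhd> \<eta>') = \<eta>' \<bullet> \<epsilon>"
    using whisker_exchange[OF ty2(2) ty1(3)] ty by (simp add: in_hom1 in_hom2)
  have x1: "(L' \<rhd> (\<epsilon> \<lhd> (R' \<cdot> (L' \<cdot> L)))) \<bullet> ((L' \<cdot> (L \<cdot> R)) \<rhd> (\<eta>' \<lhd> L)) = (L' \<rhd> (\<eta>' \<lhd> L)) \<bullet> (L' \<rhd> (\<epsilon> \<lhd> L))"
    using arg_cong[OF x, of "\<lambda>z. L' \<rhd> (z \<lhd> L)"] ty by (simp add: in_hom1 in_hom2)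
  have x2: "((R \<cdot> (R' \<cdot> L')) \<rhd> (\<epsilon> \<lhd> R')) \<bullet> (R \<rhd> (\<eta>' \<lhd> (L \<cdot> (R \<cdot> R')))) = (R \<rhd> (\<eta>' \<lhd> R')) \<bullet> (R \<rhd> (\<epsilon> \<lhd> R'))"
  proof -
    have "((R' \<cdot> L') \<rhd> \<epsilon>) \<bullet> (\<eta>' \<lhd> (L \<cdot> R)) = \<eta>' \<bullet> \<epsilon>"
      using whisker_exchange[OF ty1(3) ty2(2)] ty by (simp add: in_hom1 in_hom2)
    from arg_cong[OF this, of "\<lambda>z. R \<rhd> (z \<lhd> R')"] show ?thesis
      using ty by (simp add: in_hom1 in_hom2)
  qed
  have t1: "(L' \<rhd> (\<epsilon> \<lhd> L)) \<bullet> ((L' \<cdot> L) \<rhd> \<eta>) = id2 C (L' \<cdot> L)"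
    "(\<epsilon>' \<lhd> (L' \<cdot> L)) \<bullet> (L' \<rhd> (\<eta>' \<lhd> L)) = id2 C (L' \<cdot> L)"
    using arg_cong[OF t(1), of "\<lambda>z. L' \<rhd> z"] arg_cong[OF t'(1), of "\<lambda>z. z \<lhd> L"] ty
    by (simp_all add: in_hom1 in_hom2)
  have t2: "(R \<rhd> (\<epsilon> \<lhd> R')) \<bullet> (\<eta> \<lhd> (R \<cdot> R')) = id2 C (R \<cdot> R')"
    "((R \<cdot> R') \<rhd> \<epsilon>') \<bullet> (R \<rhd> (\<eta>' \<lhd> R')) = id2 C (R \<cdot> R')"
    using arg_cong[OF t(2), of "\<lambda>z. z \<lhd> R'"] arg_cong[OF t'(2), of "\<lambda>z. R \<rhd> z"] ty
    by (simp_all add: in_hom1 in_hom2)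
  show ?thesis
    by (rule adjunctionI[of _ A D]; use ty in \<open>simp add: in_hom1 in_hom2\<close>)
      (use ty in \<open>simp_all add: in_hom1 in_hom2 vcomp_reassoc[OF x1] vcomp_reassoc[OF x2] t1 t2
        vcomp_reassoc[OF t1(2)] vcomp_reassoc[OF t2(2)]\<close>)
qed

lemma adjunction_iso:
  assumes "adjunction C L R \<eta> \<epsilon>" "L \<in> hom1 C A B" "iso2 C \<alpha>" "\<alpha> \<in> hom2 C L L'"
  shows "adjunction C L' R ((R \<rhd> \<alpha>) \<bullet> \<eta>) (\<epsilon> \<bullet> (inv2 C \<alpha> \<lhd> R))"
proof -
  obtain ty1: "R \<in> hom1 C B A" "\<eta> \<in> hom2 C (id1 C A) (R \<cdot> L)" "\<epsilon> \<in> hom2 C (L \<cdot> R) (id1 C B)"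
    and t: "(\<epsilon> \<lhd> L) \<bullet> (L \<rhd> \<eta>) = id2 C L" "(R \<rhd> \<epsilon>) \<bullet> (\<eta> \<lhd> R) = id2 C R"
    using adjunctionE[OF assms(1,2)] by blast
  note i = inv2[OF assms(3,4)]
  have L': "L' \<in> hom1 C A B" using hom2_parallel assms by blast
  have ob: "A \<in> objs C" "B \<in> objs C" using assms by (auto simp: in_hom1)
  note ty = ob ty1 assms(2,4) L' i(1)
  let ?\<beta> = "inv2 C \<alpha>"
  let ?\<eta> = "(R \<rhd> \<alpha>) \<bullet> \<eta>"
  have \<eta>: "?\<eta> \<in> hom2 C (id1 C A) (R \<cdot> L')" using ty by (simp add: in_hom1 in_hom2)
  have x: "(?\<beta> \<lhd> (R \<cdot> L')) \<bullet> (L' \<rhd> ?\<eta>) = (L \<rhd> ?\<eta>) \<bullet> ?\<beta>"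
    using whisker_exchange[OF \<eta> i(1)] ty by (simp add: in_hom1 in_hom2)
  have y: "(\<epsilon> \<lhd> L') \<bullet> ((L \<cdot> R) \<rhd> \<alpha>) = \<alpha> \<bullet> (\<epsilon> \<lhd> L)"
    using whisker_exchange[OF assms(4) ty1(3)] ty by (simp add: in_hom1 in_hom2)
  have z: "(R \<rhd> (?\<beta> \<lhd> R)) \<bullet> (R \<rhd> (\<alpha> \<lhd> R)) = id2 C (R \<cdot> (L \<cdot> R))"
    using arg_cong[OF i(2), of "\<lambda>z. R \<rhd> (z \<lhd> R)"] ty by (simp add: in_hom1 in_hom2)
  show ?thesis
  proof (rule adjunctionI[of _ A B])
    have "((\<epsilon> \<bullet> (?\<beta> \<lhd> R)) \<lhd> L') \<bullet> (L' \<rhd> ?\<eta>) = (\<epsilon> \<lhd> L') \<bullet> ((?\<beta> \<lhd> (R \<cdot> L')) \<bullet> (L' \<rhd> ?\<eta>))"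
      using ty by (simp add: in_hom1 in_hom2)
    also have "\<dots> = (\<epsilon> \<lhd> L') \<bullet> ((L \<rhd> ?\<eta>) \<bullet> ?\<beta>)" by (simp only: x)
    also have "\<dots> = id2 C L'"
      using ty by (simp add: in_hom1 in_hom2 vcomp_reassoc[OF y] vcomp_reassoc[OF t(1)] i)
    finally show "((\<epsilon> \<bullet> (?\<beta> \<lhd> R)) \<lhd> L') \<bullet> (L' \<rhd> ?\<eta>) = id2 C L'" .
    show "(R \<rhd> (\<epsilon> \<bullet> (?\<beta> \<lhd> R))) \<bullet> (?\<eta> \<lhd> R) = id2 C R"
      using ty by (simp add: in_hom1 in_hom2 vcomp_reassoc[OF z] t(2))
  qed (use ty \<eta> in \<open>simp_all add: in_hom1 in_hom2\<close>)
qed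

section \<open>Left extensions and liftings\<close>

lemma left_extensionI:
  assumes "I \<in> hom1 C A Z" "L \<in> hom1 C A B" "R \<in> hom1 C B Z" "\<eta> \<in> hom2 C I (R \<cdot> L)"
    "\<And>M. M \<in> hom1 C B Z \<Longrightarrow>
      bij_betw (\<lambda>\<sigma>. (\<sigma> \<lhd> L) \<bullet> \<eta>) (hom2 C R M) (hom2 C I (M \<cdot> L))"
  shows "left_extension C I L R \<eta>"
  using assms by (auto simp: left_extension_def in_hom1)

lemma left_extensionD:
  assumes "left_extension C I L R \<eta>" "I \<in> hom1 C A Z" "L \<in> hom1 C A B"
  shows "R \<in> hom1 C B Z" "\<eta> \<in> hom2 C I (R \<cdot> L)"
    "M \<in> hom1 C B Z \<Longrightarrow> bij_betw (\<lambda>\<sigma>. (\<sigma> \<lhd> L) \<bullet> \<eta>) (hom2 C R M) (hom2 C I (M \<cdot> L))"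
  using assms by (auto simp: left_extension_def in_hom1)

lemma left_extension_factor:
  assumes "left_extension C I L R \<eta>" "I \<in> hom1 C A Z" "L \<in> hom1 C A B" "M \<in> hom1 C B Z"
    "\<sigma> \<in> hom2 C I (M \<cdot> L)"
  obtains \<tau> where "\<tau> \<in> hom2 C R M" "(\<tau> \<lhd> L) \<bullet> \<eta> = \<sigma>"
proof -
  have "\<sigma> \<in> (\<lambda>\<tau>. (\<tau> \<lhd> L) \<bullet> \<eta>) ` hom2 C R M"
    using bij_betw_imp_surj_on[OF left_extensionD(3)[OF assms(1-4)]] assms(5) by simp
  with that show ?thesis by blast
qed

lemma left_extension_cancel:
  assumes "left_extension C I L R \<eta>" "I \<in> hom1 C A Z" "L \<in> hom1 C A B" "M \<in> hom1 C B Z"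
    "\<tau> \<in> hom2 C R M" "\<tau>' \<in> hom2 C R M" "(\<tau> \<lhd> L) \<bullet> \<eta> = (\<tau>' \<lhd> L) \<bullet> \<eta>"
  shows "\<tau> = \<tau>'"
  using inj_onD[OF bij_betw_imp_inj_on[OF left_extensionD(3)[OF assms(1-4)]] assms(7,5,6)] .

lemma left_extension_endo_id:
  assumes "left_extension C I L R \<eta>" "I \<in> hom1 C A Z" "L \<in> hom1 C A B"
    "\<tau> \<in> hom2 C R R" "(\<tau> \<lhd> L) \<bullet> \<eta> = \<eta>"
  shows "\<tau> = id2 C R"
proof (rule left_extension_cancel[OF assms(1-3)])
  note D = left_extensionD(1,2)[OF assms(1-3)]
  show "R \<in> hom1 C B Z" by fact
  show "id2 C R \<in> hom2 C R R" "\<tau> \<in> hom2 C R R" using D assms by (simp_all add: in_hom1 in_hom2)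
  show "(\<tau> \<lhd> L) \<bullet> \<eta> = (id2 C R \<lhd> L) \<bullet> \<eta>" using D assms by (simp add: in_hom1 in_hom2)
qed

lemma left_extension_unique:
  assumes "left_extension C I L R \<eta>" "left_extension C I L R' \<eta>'" "I \<in> hom1 C A Z" "L \<in> hom1 C A B"
  obtains \<alpha> where "\<alpha> \<in> hom2 C R R'" "iso2 C \<alpha>" "(\<alpha> \<lhd> L) \<bullet> \<eta> = \<eta>'"
proof -
  note D = left_extensionD(1,2)[OF assms(1,3,4)] left_extensionD(1,2)[OF assms(2,3,4)]
  obtain \<alpha> where \<alpha>: "\<alpha> \<in> hom2 C R R'" "(\<alpha> \<lhd> L) \<bullet> \<eta> = \<eta>'"
    using left_extension_factor[OF assms(1,3,4) D(3,4)] .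
  obtain \<beta> where \<beta>: "\<beta> \<in> hom2 C R' R" "(\<beta> \<lhd> L) \<bullet> \<eta>' = \<eta>"
    using left_extension_factor[OF assms(2,3,4) D(1,2)] .
  have "\<beta> \<bullet> \<alpha> = id2 C R"
    by (rule left_extension_endo_id[OF assms(1,3,4)])
      (use D \<alpha> \<beta> assms(3,4) in \<open>simp_all add: in_hom1 in_hom2\<close>)
  moreover have "\<alpha> \<bullet> \<beta> = id2 C R'"
    by (rule left_extension_endo_id[OF assms(2,3,4)])
      (use D \<alpha> \<beta> assms(3,4) in \<open>simp_all add: in_hom1 in_hom2\<close>)
  ultimately show ?thesis
    using that[OF \<alpha>(1) iso2I[OF \<alpha>(1) \<beta>(1)] \<alpha>(2)] by simp
qed

lemma left_extension_paste:
  assumes "left_extension C I L R \<eta>" "left_extension C R M S \<theta>"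
    "I \<in> hom1 C A Z" "L \<in> hom1 C A B" "M \<in> hom1 C B D"
  shows "left_extension C I (M \<cdot> L) S ((\<theta> \<lhd> L) \<bullet> \<eta>)"
proof -
  note D = left_extensionD[OF assms(1,3,4)]
  note D' = left_extensionD[OF assms(2) D(1) assms(5)]
  note ty = assms(3-) D(1,2) D'(1,2)
  show ?thesis
  proof (rule left_extensionI[of _ A Z _ D])
    fix N assume N: "N \<in> hom1 C D Z"
    then have NM: "N \<cdot> M \<in> hom1 C B Z" using ty by (simp add: in_hom1)
    have "bij_betw ((\<lambda>\<sigma>. (\<sigma> \<lhd> L) \<bullet> \<eta>) \<circ> (\<lambda>\<sigma>. (\<sigma> \<lhd> M) \<bullet> \<theta>)) (hom2 C S N) (hom2 C I ((N \<cdot> M) \<cdot> L))"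
      by (rule bij_betw_trans[OF D'(3)[OF N] D(3)[OF NM]])
    then show "bij_betw (\<lambda>\<sigma>. (\<sigma> \<lhd> (M \<cdot> L)) \<bullet> ((\<theta> \<lhd> L) \<bullet> \<eta>)) (hom2 C S N) (hom2 C I (N \<cdot> (M \<cdot> L)))"
      by (rule bij_betw_replace)
        (use ty N in \<open>simp_all add: in_hom1 in_hom2\<close>)
  qed (use ty in \<open>simp_all add: in_hom1 in_hom2\<close>)
qed

text \<open>
  This expresses cocontinuity of \<open>T\<close> when \<open>j\<close> is a Yoneda embedding into presheaves, without
  reference to colimits.
\<close>

definition extends_restriction :: "'m \<Rightarrow> 'm \<Rightarrow> bool" where
  "extends_restriction j T \<longleftrightarrow> left_extension C (T \<cdot> j) j T (id2 C (T \<cdot> j))"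

lemma extends_restriction_iff:
  assumes "j \<in> hom1 C A B" "T \<in> hom1 C B Z"
  shows "extends_restriction j T \<longleftrightarrow>
    (\<forall>N \<in> hom1 C B Z. bij_betw (\<lambda>\<sigma>. \<sigma> \<lhd> j) (hom2 C T N) (hom2 C (T \<cdot> j) (N \<cdot> j)))"
proof -
  have "bij_betw (\<lambda>\<sigma>. (\<sigma> \<lhd> j) \<bullet> id2 C (T \<cdot> j)) (hom2 C T N) X \<longleftrightarrow>
      bij_betw (\<lambda>\<sigma>. \<sigma> \<lhd> j) (hom2 C T N) X" for N X
    by (rule bij_betw_cong) (use assms in \<open>simp add: in_hom1 in_hom2\<close>)
  then show ?thesis
    using assms unfolding extends_restriction_def left_extension_def by (auto simp: in_hom1 in_hom2)
qed

lemma extends_restriction_bij: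
  assumes "extends_restriction j T" "j \<in> hom1 C A B" "T \<in> hom1 C B Z" "N \<in> hom1 C B Z"
  shows "bij_betw (\<lambda>\<sigma>. \<sigma> \<lhd> j) (hom2 C T N) (hom2 C (T \<cdot> j) (N \<cdot> j))"
  using assms by (simp add: extends_restriction_iff)

text \<open>
  An extension exhibited by an invertible 2-cell has restriction isomorphic to the 1-cell extended, and
  precomposition with the isomorphism does not affect universality.
\<close>

lemma extends_restriction_if_cell_iso:
  assumes "left_extension C I j T \<gamma>" "iso2 C \<gamma>" "I \<in> hom1 C A Z" "j \<in> hom1 C A B"
  shows "extends_restriction j T"
proof -
  note D = left_extensionD[OF assms(1,3,4)]
  show ?thesis
    unfolding extends_restriction_iff[OF assms(4) D(1)]
  proof
    fix N assume N: "N \<in> hom1 C B Z"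
    have "bij_betw ((\<lambda>\<sigma>. \<sigma> \<bullet> \<gamma>) \<circ> (\<lambda>\<sigma>. \<sigma> \<lhd> j)) (hom2 C T N) (hom2 C I (N \<cdot> j))"
      using D(3)[OF N] by (simp add: comp_def)
    then show "bij_betw (\<lambda>\<sigma>. \<sigma> \<lhd> j) (hom2 C T N) (hom2 C (T \<cdot> j) (N \<cdot> j))"
      by (subst bij_betw_comp_iff2[OF bij_precomp_iso2[OF assms(2) D(2)]])
        (use D(1) N assms(3,4) in \<open>auto simp: in_hom1 in_hom2\<close>)
  qed
qed

lemma extends_restriction_iso:
  assumes "extends_restriction j T" "iso2 C \<alpha>" "\<alpha> \<in> hom2 C T T'" "j \<in> hom1 C A B" "T \<in> hom1 C B Z"
  shows "extends_restriction j T'"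
proof -
  have T': "T' \<in> hom1 C B Z" using hom2_parallel assms(3,5) by blast
  have \<alpha>j: "\<alpha> \<lhd> j \<in> hom2 C (T \<cdot> j) (T' \<cdot> j)"
    using assms T' by (simp add: in_hom1 in_hom2)
  show ?thesis
    unfolding extends_restriction_iff[OF assms(4) T']
  proof
    fix N assume N: "N \<in> hom1 C B Z"
    have "bij_betw ((\<lambda>\<sigma>. \<sigma> \<lhd> j) \<circ> (\<lambda>\<sigma>. \<sigma> \<bullet> \<alpha>)) (hom2 C T' N) (hom2 C (T \<cdot> j) (N \<cdot> j))"
      by (rule bij_betw_trans[OF bij_precomp_iso2[OF assms(2,3)]
            extends_restriction_bij[OF assms(1,4,5) N]])
    then have "bij_betw ((\<lambda>\<sigma>. \<sigma> \<bullet> (\<alpha> \<lhd> j)) \<circ> (\<lambda>\<sigma>. \<sigma> \<lhd> j)) (hom2 C T' N) (hom2 C (T \<cdot> j) (N \<cdot> j))"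
      by (rule bij_betw_replace)
        (use assms(3-) T' N in \<open>simp_all add: in_hom1 in_hom2\<close>)
    then show "bij_betw (\<lambda>\<sigma>. \<sigma> \<lhd> j) (hom2 C T' N) (hom2 C (T' \<cdot> j) (N \<cdot> j))"
      by (subst bij_betw_comp_iff2[OF bij_precomp_iso2[OF iso2_whisker_r[OF assms(2,3,5,4)] \<alpha>j]])
        (use T' N assms(4) in \<open>auto simp: in_hom1 in_hom2\<close>)
  qed
qed

lemma iso_of_restriction_iso:
  assumes "extends_restriction j T" "extends_restriction j T'" "iso2 C \<alpha>" "\<alpha> \<in> hom2 C (T \<cdot> j) (T' \<cdot> j)"
    "j \<in> hom1 C A B" "T \<in> hom1 C B Z" "T' \<in> hom1 C B Z"
  obtains \<beta> where "\<beta> \<in> hom2 C T T'" "iso2 C \<beta>" "\<beta> \<lhd> j = \<alpha>"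
proof -
  \<comment> \<open>\<open>T'\<close> is also a left extension of the restriction of \<open>T\<close>, so uniqueness applies.\<close>
  have ext: "left_extension C (T \<cdot> j) j T' \<alpha>"
  proof (rule left_extensionI[of _ A Z _ B])
    fix N assume N: "N \<in> hom1 C B Z"
    have "bij_betw ((\<lambda>\<sigma>. \<sigma> \<bullet> \<alpha>) \<circ> (\<lambda>\<sigma>. \<sigma> \<lhd> j)) (hom2 C T' N) (hom2 C (T \<cdot> j) (N \<cdot> j))"
      by (rule bij_betw_trans[OF extends_restriction_bij[OF assms(2,5,7) N] bij_precomp_iso2[OF assms(3,4)]])
    then show "bij_betw (\<lambda>\<sigma>. (\<sigma> \<lhd> j) \<bullet> \<alpha>) (hom2 C T' N) (hom2 C (T \<cdot> j) (N \<cdot> j))"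
      by (simp add: comp_def)
  qed (use assms in \<open>simp_all add: in_hom1 in_hom2\<close>)
  have Tj: "T \<cdot> j \<in> hom1 C A Z" using assms by (simp add: in_hom1)
  obtain \<beta> where "\<beta> \<in> hom2 C T T'" "iso2 C \<beta>" "(\<beta> \<lhd> j) \<bullet> id2 C (T \<cdot> j) = \<alpha>"
    using left_extension_unique[OF assms(1)[unfolded extends_restriction_def] ext Tj assms(5)] .
  with that show ?thesis using assms by (simp add: in_hom1 in_hom2)
qed

text \<open>
  For \<open>N : D \<rightarrow> Z\<close> the correspondence is the chain
  \<open>Q \<cdot> R \<rightarrow> N\<close>, \<open>Q \<rightarrow> N \<cdot> F\<close>, \<open>Q \<cdot> j \<rightarrow> N \<cdot> F \<cdot> j\<close>, \<open>Q \<cdot> j \<rightarrow> N \<cdot> K\<close>,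
  by transposition, by the universal property of \<open>Q\<close>, and by the isomorphism \<open>c\<close>.
\<close>

lemma left_extension_right_adjoint:
  assumes "extends_restriction j Q" "adjunction C F R \<eta> \<epsilon>"
    "iso2 C c" "c \<in> hom2 C K (F \<cdot> j)"
    "j \<in> hom1 C A B" "Q \<in> hom1 C B Z" "F \<in> hom1 C B D"
  shows "left_extension C (Q \<cdot> j) K (Q \<cdot> R) (Q \<rhd> ((R \<rhd> inv2 C c) \<bullet> (\<eta> \<lhd> j)))"
proof -
  obtain ty0: "R \<in> hom1 C D B" "\<eta> \<in> hom2 C (id1 C B) (R \<cdot> F)"
    using adjunctionE[OF assms(2,7)] by blast
  note i = inv2[OF assms(3,4)]
  have Fj: "F \<cdot> j \<in> hom1 C A D" using assms by (simp add: in_hom1)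
  have K: "K \<in> hom1 C A D" using hom2_parallel[OF i(1) Fj] .
  note ty = ty0 i(1) K assms(4-) Fj
  have ob: "B \<in> objs C" using assms(5) by (auto simp: in_hom1)
  show ?thesis
  proof (rule left_extensionI[of _ A Z _ D])
    fix N assume N: "N \<in> hom1 C D Z"
    then have NF: "N \<cdot> F \<in> hom1 C B Z" using ty by (simp add: in_hom1)
    have d: "iso2 C (N \<rhd> inv2 C c)" "N \<rhd> inv2 C c \<in> hom2 C (N \<cdot> (F \<cdot> j)) (N \<cdot> K)"
      using iso2_whisker_l[OF iso2_inverse[OF assms(3,4)] i(1) Fj N] ty N
      by (simp_all add: in_hom1 in_hom2)
    have "bij_betw ((\<lambda>\<sigma>. (N \<rhd> inv2 C c) \<bullet> \<sigma>) \<circ> ((\<lambda>\<sigma>. \<sigma> \<lhd> j) \<circ> (\<lambda>\<sigma>. (\<sigma> \<lhd> F) \<bullet> (Q \<rhd> \<eta>))))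
        (hom2 C (Q \<cdot> R) N) (hom2 C (Q \<cdot> j) (N \<cdot> K))"
      by (rule bij_betw_trans[OF bij_betw_trans[OF bij_transpose_precomp[OF assms(2,7,6) N]
              extends_restriction_bij[OF assms(1,5,6) NF]]])
        (use bij_postcomp_iso2[OF d, of "Q \<cdot> j"] ty N in \<open>simp add: in_hom1\<close>)
    moreover have "((\<lambda>\<sigma>. (N \<rhd> inv2 C c) \<bullet> \<sigma>) \<circ> ((\<lambda>\<sigma>. \<sigma> \<lhd> j) \<circ> (\<lambda>\<sigma>. (\<sigma> \<lhd> F) \<bullet> (Q \<rhd> \<eta>)))) \<sigma> =
        (\<sigma> \<lhd> K) \<bullet> (Q \<rhd> ((R \<rhd> inv2 C c) \<bullet> (\<eta> \<lhd> j)))" if s: "\<sigma> \<in> hom2 C (Q \<cdot> R) N" for \<sigma>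
    proof -
      have e: "(\<sigma> \<lhd> K) \<bullet> ((Q \<cdot> R) \<rhd> inv2 C c) = (N \<rhd> inv2 C c) \<bullet> (\<sigma> \<lhd> (F \<cdot> j))"
        using whisker_exchange[OF i(1) s] ty by (simp add: in_hom1)
      show ?thesis
        using ty N s ob by (simp add: in_hom1 in_hom2 vcomp_reassoc[OF e])
    qed
    ultimately show "bij_betw (\<lambda>\<sigma>. (\<sigma> \<lhd> K) \<bullet> (Q \<rhd> ((R \<rhd> inv2 C c) \<bullet> (\<eta> \<lhd> j))))
        (hom2 C (Q \<cdot> R) N) (hom2 C (Q \<cdot> j) (N \<cdot> K))"
      by (rule bij_betw_replace) simp_all
  qed (use ty ob in \<open>simp_all add: in_hom1 in_hom2\<close>)
qed

text \<open>
  For \<open>N : X \<rightarrow> D\<close> the correspondence is the chain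
  \<open>M \<cdot> G \<rightarrow> N\<close>, \<open>k \<cdot> M \<cdot> G \<rightarrow> k \<cdot> N\<close>, \<open>F \<cdot> j \<cdot> G \<rightarrow> k \<cdot> N\<close>, \<open>j \<cdot> G \<rightarrow> R \<cdot> k \<cdot> N\<close>,
  by full faithfulness of \<open>k\<close>, by the isomorphism \<open>c\<close>, and by transposition. The 1-cell \<open>G\<close> is there
  to make the lifting absolute.
\<close>

lemma left_lifting_right_adjoint:
  assumes "fully_faithful C k" "adjunction C F R \<eta> \<epsilon>"
    "iso2 C c" "c \<in> hom2 C (k \<cdot> M) (F \<cdot> j)"
    "j \<in> hom1 C A B" "M \<in> hom1 C A D" "k \<in> hom1 C D E" "F \<in> hom1 C B E" "G \<in> hom1 C X A"
  shows "left_lifting C (j \<cdot> G) (R \<cdot> k) (M \<cdot> G) (((R \<rhd> inv2 C c) \<bullet> (\<eta> \<lhd> j)) \<lhd> G)"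
proof -
  obtain ty0: "R \<in> hom1 C E B" "\<eta> \<in> hom2 C (id1 C B) (R \<cdot> F)"
    using adjunctionE[OF assms(2,8)] by blast
  note i = inv2[OF assms(3,4)]
  note ty = ty0 i(1) assms(4-)
  have ob: "B \<in> objs C" "X \<in> objs C" using assms by (auto simp: in_hom1)
  have R: "src1 C (R \<cdot> k) = D" "src1 C (j \<cdot> G) = X" "tgt1 C (j \<cdot> G) = B" using ty by (auto simp: in_hom1)
  have "bij_betw (\<lambda>\<delta>. ((R \<cdot> k) \<rhd> \<delta>) \<bullet> (((R \<rhd> inv2 C c) \<bullet> (\<eta> \<lhd> j)) \<lhd> G))
      (hom2 C (M \<cdot> G) N) (hom2 C (j \<cdot> G) ((R \<cdot> k) \<cdot> N))" if N: "N \<in> hom1 C X D" for N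
  proof -
    have MG: "M \<cdot> G \<in> hom1 C X D" "j \<cdot> G \<in> hom1 C X B" "k \<cdot> N \<in> hom1 C X E"
      using ty N by (simp_all add: in_hom1)
    have kff: "bij_betw (\<lambda>\<sigma>. k \<rhd> \<sigma>) (hom2 C (M \<cdot> G) N) (hom2 C (k \<cdot> (M \<cdot> G)) (k \<cdot> N))"
      using assms(1) MG N ty ob unfolding fully_faithful_def by (auto simp: in_hom1)
    have d: "iso2 C (inv2 C c \<lhd> G)" "inv2 C c \<lhd> G \<in> hom2 C (F \<cdot> (j \<cdot> G)) (k \<cdot> (M \<cdot> G))"
      using iso2_whisker_r[OF iso2_inverse[OF assms(3,4)] i(1), of A E G X] ty
      by (simp_all add: in_hom1 in_hom2)
    have "bij_betw ((\<lambda>\<delta>. (R \<rhd> \<delta>) \<bullet> (\<eta> \<lhd> (j \<cdot> G))) \<circ> ((\<lambda>\<sigma>. \<sigma> \<bullet> (inv2 C c \<lhd> G)) \<circ> (\<lambda>\<sigma>. k \<rhd> \<sigma>)))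
      (hom2 C (M \<cdot> G) N) (hom2 C (j \<cdot> G) (R \<cdot> (k \<cdot> N)))"
      by (rule bij_betw_trans[OF bij_betw_trans[OF kff bij_precomp_iso2[OF d]]
            bij_transpose_postcomp[OF assms(2,8) MG(2,3)]])
    then show ?thesis
      by (rule bij_betw_replace)
        (use ty N ob in \<open>simp_all add: in_hom1 in_hom2\<close>)
  qed
  then show ?thesis
    unfolding left_lifting_def R using ty ob by (auto simp: in_hom1 in_hom2)
qed

end

section \<open>KZ doctrines\<close>

context kz_doctrine
begin

abbreviation P where "P \<equiv> kz_P K"
abbreviation y where "y \<equiv> kz_y K"

lemma y_cells [simp]:
  assumes "A \<in> objs C"
  shows "kz_P K A \<in> objs C" "kz_y K A \<in> cells1 C" "src1 C (kz_y K A) = A" "tgt1 C (kz_y K A) = kz_P K A"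
  using P_obj y_hom assms by (auto simp: in_hom1)

lemma lan_hom:
  assumes "A \<in> objs C" "B \<in> objs C" "F \<in> hom1 C A (P B)"
  shows "kz_lan K A B F \<in> hom1 C (P A) (P B)"
    "kz_lan_cell K A B F \<in> hom2 C F (kz_lan K A B F \<cdot> y A)"
  using left_extensionD[OF ext_left_extension[OF assms] assms(3) y_hom] assms(1) by auto

lemma lan_extends_restriction:
  assumes "A \<in> objs C" "B \<in> objs C" "F \<in> hom1 C A (P B)"
  shows "extends_restriction (y A) (kz_lan K A B F)"
  using extends_restriction_if_cell_iso[OF ext_left_extension cell_iso] assms y_hom by blast

lemma id_extends_restriction:
  assumes "A \<in> objs C"
  shows "extends_restriction (y A) (id1 C (P A))"
  using lan_extends_restriction[of A A "y A"] assms ext_y y_hom by auto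

lemma iso_lan_restriction:
  assumes "extends_restriction (y A) T" "A \<in> objs C" "B \<in> objs C" "T \<in> hom1 C (P A) (P B)"
  obtains \<alpha> where "\<alpha> \<in> hom2 C (kz_lan K A B (T \<cdot> y A)) T" "iso2 C \<alpha>"
    "(\<alpha> \<lhd> y A) \<bullet> kz_lan_cell K A B (T \<cdot> y A) = id2 C (T \<cdot> y A)"
proof -
  have Ty: "T \<cdot> y A \<in> hom1 C A (P B)" using assms by (simp add: in_hom1)
  show ?thesis
    using left_extension_unique[OF ext_left_extension[OF assms(2,3) Ty]
        assms(1)[unfolded extends_restriction_def] Ty y_hom] assms(2) that by blast
qed

text \<open>
  Both factors are isomorphic to chosen extensions, and for those the claim is that chosen extensions
  respect each other.
\<close>

lemma extends_restriction_comp: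
  assumes "extends_restriction (y A) T" "extends_restriction (y B) S"
    "A \<in> objs C" "B \<in> objs C" "D \<in> objs C" "T \<in> hom1 C (P A) (P B)" "S \<in> hom1 C (P B) (P D)"
  shows "extends_restriction (y A) (S \<cdot> T)"
proof -
  have h: "T \<cdot> y A \<in> hom1 C A (P B)" "S \<cdot> y B \<in> hom1 C B (P D)"
    using assms by (simp_all add: in_hom1)
  let ?T = "kz_lan K A B (T \<cdot> y A)" and ?S = "kz_lan K B D (S \<cdot> y B)"
  let ?c = "kz_lan_cell K A B (T \<cdot> y A)"
  note lT = lan_hom[OF assms(3,4) h(1)] and lS = lan_hom[OF assms(4,5) h(2)]
  obtain \<alpha> where \<alpha>: "\<alpha> \<in> hom2 C ?T T" "iso2 C \<alpha>"
    using iso_lan_restriction[OF assms(1,3,4,6)] by blast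
  obtain \<beta> where \<beta>: "\<beta> \<in> hom2 C ?S S" "iso2 C \<beta>"
    using iso_lan_restriction[OF assms(2,4,5,7)] by blast
  have "extends_restriction (y A) (?S \<cdot> ?T)"
    by (rule extends_restriction_if_cell_iso[of "?S \<cdot> (T \<cdot> y A)" _ _ "?S \<rhd> ?c" A "P D" "P A"])
      (use ext_respects[OF assms(3-5) h] iso2_whisker_l[OF cell_iso[OF assms(3,4) h(1)] lT(2) h(1) lS(1)]
          h lT lS assms y_hom in \<open>simp_all add: respects_left_extension_def in_hom1\<close>)
  moreover have "iso2 C ((\<beta> \<lhd> T) \<bullet> (?S \<rhd> \<alpha>))"
    by (rule iso2_vcomp[OF iso2_whisker_l[OF \<alpha>(2,1) lT(1) lS(1)] _ iso2_whisker_r[OF \<beta>(2,1) lS(1) assms(6)]])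
      (use \<alpha> \<beta> lT lS assms in \<open>simp_all add: in_hom1 in_hom2\<close>)
  ultimately show ?thesis
    by (rule extends_restriction_iso[of _ _ _ _ A "P A" "P D"])
      (use \<alpha> \<beta> lT lS assms y_hom in \<open>simp_all add: in_hom1 in_hom2\<close>)
qed

text \<open>
  Every \<open>N : B \<rightarrow> P E\<close> is isomorphic to the restriction along \<open>y B\<close> of its extension \<open>kz_lan K B E N\<close>.
  Hence 2-cells \<open>T \<cdot> y B \<rightarrow> N\<close> are 2-cells from \<open>T\<close> to that extension, to which the universal property
  along \<open>y B \<cdot> L\<close> applies.
\<close>

lemma left_extension_restrict_unit:
  assumes "extends_restriction (y B) T" "left_extension C I (y B \<cdot> L) T \<phi>"
    "L \<in> hom1 C A B" "I \<in> hom1 C A (P E)" "E \<in> objs C" "T \<in> hom1 C (P B) (P E)"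
  shows "left_extension C I L (T \<cdot> y B) \<phi>"
proof -
  have ob: "A \<in> objs C" "B \<in> objs C" using assms by (auto simp: in_hom1)
  have yL: "y B \<cdot> L \<in> hom1 C A (P B)" using assms ob by (simp add: in_hom1)
  note D = left_extensionD[OF assms(2,4) yL]
  show ?thesis
  proof (rule left_extensionI[of _ A "P E" _ B])
    fix N assume N: "N \<in> hom1 C B (P E)"
    let ?N = "kz_lan K B E N" and ?c = "kz_lan_cell K B E N"
    note l = lan_hom[OF ob(2) assms(5) N] and ci = cell_iso[OF ob(2) assms(5) N]
    note i = inv2[OF ci l(2)] and ii = iso2_inverse[OF ci l(2)]
    have Ny: "?N \<cdot> y B \<in> hom1 C B (P E)" using l ob by (simp add: in_hom1)
    have f: "bij_betw ((\<lambda>\<sigma>. inv2 C ?c \<bullet> \<sigma>) \<circ> (\<lambda>\<sigma>. \<sigma> \<lhd> y B)) (hom2 C T ?N) (hom2 C (T \<cdot> y B) N)"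
      by (rule bij_betw_trans[OF extends_restriction_bij[OF assms(1) y_hom[OF ob(2)] assms(6) l(1)]
            bij_postcomp_iso2[OF ii i(1)]])
    \<comment> \<open>The correspondence is sought on \<open>T \<cdot> y B \<rightarrow> N\<close>; preceded by the bijection \<open>f\<close> it becomes the one
      given by the universal property of \<open>T\<close>.\<close>
    have d: "iso2 C (inv2 C ?c \<lhd> L)" "inv2 C ?c \<lhd> L \<in> hom2 C (?N \<cdot> (y B \<cdot> L)) (N \<cdot> L)"
      using iso2_whisker_r[OF ii i(1) Ny assms(3)] i(1) N l assms ob by (simp_all add: in_hom1 in_hom2)
    have "bij_betw ((\<lambda>\<sigma>. (inv2 C ?c \<lhd> L) \<bullet> \<sigma>) \<circ> (\<lambda>\<sigma>. (\<sigma> \<lhd> (y B \<cdot> L)) \<bullet> \<phi>)) (hom2 C T ?N) (hom2 C I (N \<cdot> L))"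
      by (rule bij_betw_trans[OF D(3)[OF l(1)] bij_postcomp_iso2[OF d]])
    then have "bij_betw ((\<lambda>\<sigma>. (\<sigma> \<lhd> L) \<bullet> \<phi>) \<circ> ((\<lambda>\<sigma>. inv2 C ?c \<bullet> \<sigma>) \<circ> (\<lambda>\<sigma>. \<sigma> \<lhd> y B)))
        (hom2 C T ?N) (hom2 C I (N \<cdot> L))"
      by (rule bij_betw_replace)
        (use D(1,2) i(1) l N assms ob in \<open>simp_all add: in_hom1 in_hom2\<close>)
    then show "bij_betw (\<lambda>\<sigma>. (\<sigma> \<lhd> L) \<bullet> \<phi>) (hom2 C (T \<cdot> y B) N) (hom2 C I (N \<cdot> L))"
      using bij_betw_comp_iff[OF f] by blast
  qed (use D(1,2) assms ob in \<open>simp_all add: in_hom1 in_hom2\<close>)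
qed

lemma kz_map_extension:
  assumes "L \<in> hom1 C A B"
  shows "kz_map C K L \<in> hom1 C (P A) (P B)" "extends_restriction (y A) (kz_map C K L)"
    "kz_map_cell C K L \<in> hom2 C (y B \<cdot> L) (kz_map C K L \<cdot> y A)" "iso2 C (kz_map_cell C K L)"
proof -
  have o: "A \<in> objs C" "B \<in> objs C" "src1 C L = A" "tgt1 C L = B" using assms by (auto simp: in_hom1)
  have h: "y B \<cdot> L \<in> hom1 C A (P B)" using assms o by (simp add: in_hom1)
  show "kz_map C K L \<in> hom1 C (P A) (P B)" "extends_restriction (y A) (kz_map C K L)"
    "kz_map_cell C K L \<in> hom2 C (y B \<cdot> L) (kz_map C K L \<cdot> y A)" "iso2 C (kz_map_cell C K L)"
    using lan_hom[OF o(1,2) h] lan_extends_restriction[OF o(1,2) h] cell_iso[OF o(1,2) h]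
    by (simp_all add: kz_map_def kz_map_cell_def o)
qed

text \<open>
  Both sides extend their restrictions, and these are both isomorphic to \<open>y D \<cdot> M \<cdot> L\<close>.
\<close>

lemma kz_map_comp_iso:
  assumes "L \<in> hom1 C A B" "M \<in> hom1 C B D"
  obtains \<alpha> where "\<alpha> \<in> hom2 C (kz_map C K M \<cdot> kz_map C K L) (kz_map C K (M \<cdot> L))" "iso2 C \<alpha>"
proof -
  have ob: "A \<in> objs C" "B \<in> objs C" "D \<in> objs C" using assms by (auto simp: in_hom1)
  have LM: "M \<cdot> L \<in> hom1 C A D" using assms by (simp add: in_hom1)
  let ?L = "kz_map C K L" and ?M = "kz_map C K M" and ?N = "kz_map C K (M \<cdot> L)"
  let ?l = "kz_map_cell C K L" and ?m = "kz_map_cell C K M" and ?n = "kz_map_cell C K (M \<cdot> L)"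
  note L = kz_map_extension[OF assms(1)] and M = kz_map_extension[OF assms(2)] and N = kz_map_extension[OF LM]
  note i = iso2_inverse[OF L(4,3)] inv2(1)[OF L(4,3)] iso2_inverse[OF M(4,3)] inv2(1)[OF M(4,3)]
  have h: "?L \<cdot> y A \<in> hom1 C A (P B)" "?M \<cdot> y B \<in> hom1 C B (P D)"
    using L(1) M(1) ob by (simp_all add: in_hom1)
  \<comment> \<open>The isomorphism \<open>P M \<cdot> P L \<cdot> y A \<rightarrow> P M \<cdot> y B \<cdot> L \<rightarrow> y D \<cdot> M \<cdot> L \<rightarrow> P (M \<cdot> L) \<cdot> y A\<close> is built in steps.\<close>
  have 1: "iso2 C (?M \<rhd> inv2 C ?l)" "?M \<rhd> inv2 C ?l \<in> hom2 C (?M \<cdot> (?L \<cdot> y A)) (?M \<cdot> (y B \<cdot> L))"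
    using iso2_whisker_l[OF i(1,2) h(1) M(1)] i(2) h M(1) L(1) ob by (simp_all add: in_hom1 in_hom2)
  have 2: "iso2 C (inv2 C ?m \<lhd> L)" "inv2 C ?m \<lhd> L \<in> hom2 C (?M \<cdot> (y B \<cdot> L)) (y D \<cdot> (M \<cdot> L))"
    using iso2_whisker_r[OF i(3,4) h(2) assms(1)] i(4) h M(1) L(1) ob assms by (simp_all add: in_hom1 in_hom2)
  have 3: "(inv2 C ?m \<lhd> L) \<bullet> (?M \<rhd> inv2 C ?l) \<in> hom2 C (?M \<cdot> (?L \<cdot> y A)) (y D \<cdot> (M \<cdot> L))"
    using vcomp_hom[OF 1(2) 2(2)] .
  have 4: "iso2 C (?n \<bullet> ((inv2 C ?m \<lhd> L) \<bullet> (?M \<rhd> inv2 C ?l)))"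
    "?n \<bullet> ((inv2 C ?m \<lhd> L) \<bullet> (?M \<rhd> inv2 C ?l)) \<in> hom2 C ((?M \<cdot> ?L) \<cdot> y A) (?N \<cdot> y A)"
    using iso2_vcomp[OF iso2_vcomp[OF 1 2] 3 N(4,3)] vcomp_hom[OF 3 N(3)] L(1) M(1) ob
    by (simp_all add: in_hom1)
  have comp_hom: "?M \<cdot> ?L \<in> hom1 C (P A) (P D)" using L(1) M(1) by (simp add: in_hom1)
  show ?thesis
    using iso_of_restriction_iso[OF extends_restriction_comp[OF L(2) M(2) ob L(1) M(1)] N(2) 4
        y_hom[OF ob(1)] comp_hom N(1)] that by blast
qed

lemma admissibleE:
  assumes "admissible C K L"
  obtains R \<eta> \<epsilon> where "adjunction C (kz_map C K L) R \<eta> \<epsilon>"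
  using assms by (auto simp: admissible_def has_right_adjoint_def right_adjoint_unit_def)

lemma admissibleI:
  assumes "adjunction C (kz_map C K L) R \<eta> \<epsilon>" "L \<in> cells1 C"
  shows "admissible C K L"
  using assms by (auto simp: admissible_def has_right_adjoint_def right_adjoint_unit_def)

lemma admissible_comp:
  assumes "admissible C K L" "admissible C K M" "L \<in> hom1 C A B" "M \<in> hom1 C B D"
  shows "admissible C K (M \<cdot> L)"
proof -
  obtain R \<eta> \<epsilon> where 1: "adjunction C (kz_map C K L) R \<eta> \<epsilon>" using admissibleE assms(1) .
  obtain R' \<eta>' \<epsilon>' where 2: "adjunction C (kz_map C K M) R' \<eta>' \<epsilon>'" using admissibleE assms(2) .
  note h = kz_map_extension(1)[OF assms(3)] kz_map_extension(1)[OF assms(4)]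
  have 3: "kz_map C K M \<cdot> kz_map C K L \<in> hom1 C (P A) (P D)" using h by (simp add: in_hom1)
  obtain \<alpha> where \<alpha>: "\<alpha> \<in> hom2 C (kz_map C K M \<cdot> kz_map C K L) (kz_map C K (M \<cdot> L))" "iso2 C \<alpha>"
    using kz_map_comp_iso[OF assms(3,4)] .
  show ?thesis
    by (rule admissibleI[OF adjunction_iso[OF adjunction_comp[OF 1 h(1) 2 h(2)] 3 \<alpha>(2,1)]])
      (use assms in \<open>simp add: in_hom1\<close>)
qed

text \<open>
  Write \<open>L = P y\<^sub>A\<close> and let \<open>R\<close> be the extension of the identity, with \<open>r : id \<rightarrow> R \<cdot> y\<^bsub>PA\<^esub>\<close>. The unit
  is determined by its restriction to \<open>A\<close>, where \<open>id\<close> and \<open>R \<cdot> L\<close> are canonically isomorphic. The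
  counit comes from \<open>L \<cdot> R\<close> being an extension of \<open>L\<close> along \<open>y\<^bsub>PA\<^esub>\<close>: it corresponds to the 2-cell
  \<open>\<theta> : L \<rightarrow> y\<^bsub>PA\<^esub>\<close> that restricts to the canonical isomorphism on \<open>A\<close>.
\<close>

lemma kz_map_unit_adjunction:
  assumes "A \<in> objs C"
  obtains \<eta> \<epsilon> where "adjunction C (kz_map C K (y A)) (kz_lan K (P A) A (id1 C (P A))) \<eta> \<epsilon>"
proof -
  let ?L = "kz_map C K (y A)" and ?l = "kz_map_cell C K (y A)"
  let ?R = "kz_lan K (P A) A (id1 C (P A))" and ?r = "kz_lan_cell K (P A) A (id1 C (P A))"
  let ?Y = "y (P A)"
  have PA: "P A \<in> objs C" "P (P A) \<in> objs C" using assms by simp_all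
  have id: "id1 C (P A) \<in> hom1 C (P A) (P A)" using assms by (simp add: in_hom1)
  note L = kz_map_extension[OF y_hom[OF assms]]
  note R = lan_hom[OF PA(1) assms id] lan_extends_restriction[OF PA(1) assms id] cell_iso[OF PA(1) assms id]
  note id_ext = id_extends_restriction[OF assms]
  note yA = y_hom[OF assms]
  note ty = L(1,3) R(1,2) assms PA
  have RL: "?R \<cdot> ?L \<in> hom1 C (P A) (P A)" using ty by (simp add: in_hom1)
  have Yy: "?Y \<cdot> y A \<in> hom1 C A (P (P A))" using ty by (simp add: in_hom1)
  have \<eta>0: "iso2 C ((?R \<rhd> ?l) \<bullet> (?r \<lhd> y A))"
    "(?R \<rhd> ?l) \<bullet> (?r \<lhd> y A) \<in> hom2 C (id1 C (P A) \<cdot> y A) ((?R \<cdot> ?L) \<cdot> y A)"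
    using iso2_vcomp[OF iso2_whisker_r[OF R(4,2) id yA] _ iso2_whisker_l[OF L(4,3) Yy R(1)]]
      ty by (simp_all add: in_hom1 in_hom2)
  obtain \<eta> where \<eta>: "\<eta> \<in> hom2 C (id1 C (P A)) (?R \<cdot> ?L)" "\<eta> \<lhd> y A = (?R \<rhd> ?l) \<bullet> (?r \<lhd> y A)"
    using iso_of_restriction_iso[OF id_ext extends_restriction_comp[OF L(2) R(3) assms PA(1) assms L(1) R(1)]
       \<eta>0 yA id RL] by blast
  have L_ext: "left_extension C (?Y \<cdot> y A) (y A) ?L ?l"
    using ext_left_extension[OF assms PA(1), of "?Y \<cdot> y A"] ty
    by (simp add: kz_map_def kz_map_cell_def in_hom1)
  obtain \<theta> where \<theta>: "\<theta> \<in> hom2 C ?L ?Y" "(\<theta> \<lhd> y A) \<bullet> ?l = id2 C (?Y \<cdot> y A)"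
    using left_extension_factor[OF L_ext Yy yA y_hom[OF PA(1)], of "id2 C (?Y \<cdot> y A)"] ty
    by (auto simp: in_hom1 in_hom2)
  have LR_ext: "left_extension C ?L ?Y (?L \<cdot> ?R) (?L \<rhd> ?r)"
    using ext_respects[OF PA(1) assms PA(1) id, of "?Y \<cdot> y A"] ty
    by (simp add: respects_left_extension_def kz_map_def in_hom1)
  obtain \<epsilon> where \<epsilon>: "\<epsilon> \<in> hom2 C (?L \<cdot> ?R) (id1 C (P (P A)))" "(\<epsilon> \<lhd> ?Y) \<bullet> (?L \<rhd> ?r) = \<theta>"
    using left_extension_factor[OF LR_ext L(1) y_hom[OF PA(1)], of "id1 C (P (P A))" \<theta>] ty \<theta>
    by (auto simp: in_hom1)
  have t1: "(\<epsilon> \<lhd> ?L) \<bullet> (?L \<rhd> \<eta>) = id2 C ?L"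
  proof (rule left_extension_endo_id[OF L_ext Yy yA])
    show "(\<epsilon> \<lhd> ?L) \<bullet> (?L \<rhd> \<eta>) \<in> hom2 C ?L ?L" using ty \<eta> \<epsilon> by (simp add: in_hom1 in_hom2)
    have a: "(?L \<rhd> (\<eta> \<lhd> y A)) \<bullet> ?l = ((?L \<cdot> ?R) \<rhd> ?l) \<bullet> ((?L \<rhd> (?r \<lhd> y A)) \<bullet> ?l)"
      using ty unfolding \<eta>(2) by (simp add: in_hom1 in_hom2)
    have b: "(\<epsilon> \<lhd> (?L \<cdot> y A)) \<bullet> ((?L \<cdot> ?R) \<rhd> ?l) = ?l \<bullet> (\<epsilon> \<lhd> (?Y \<cdot> y A))"
      using whisker_exchange[OF L(3) \<epsilon>(1)] ty by (simp add: in_hom1 in_hom2)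
    have c: "(\<epsilon> \<lhd> (?Y \<cdot> y A)) \<bullet> (?L \<rhd> (?r \<lhd> y A)) = \<theta> \<lhd> y A"
      using arg_cong[OF \<epsilon>(2), of "\<lambda>z. z \<lhd> y A"] ty \<epsilon>(1) by (simp add: in_hom1 in_hom2)
    show "(((\<epsilon> \<lhd> ?L) \<bullet> (?L \<rhd> \<eta>)) \<lhd> y A) \<bullet> ?l = ?l"
      using ty \<eta>(1) \<epsilon>(1) \<theta> by (simp add: in_hom1 in_hom2 a vcomp_reassoc[OF b] vcomp_reassoc[OF c])
  qed
  have t2: "(?R \<rhd> \<epsilon>) \<bullet> (\<eta> \<lhd> ?R) = id2 C ?R"
  proof (rule left_extension_endo_id[OF ext_left_extension[OF PA(1) assms id] id y_hom[OF PA(1)]])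
    show "(?R \<rhd> \<epsilon>) \<bullet> (\<eta> \<lhd> ?R) \<in> hom2 C ?R ?R" using ty \<eta> \<epsilon> by (simp add: in_hom1 in_hom2)
    have a: "(\<eta> \<lhd> (?R \<cdot> ?Y)) \<bullet> ?r = ((?R \<cdot> ?L) \<rhd> ?r) \<bullet> \<eta>"
      using whisker_exchange[OF R(2) \<eta>(1)] ty \<eta> by (simp add: in_hom1 in_hom2)
    have b: "(?R \<rhd> (\<epsilon> \<lhd> ?Y)) \<bullet> ((?R \<cdot> ?L) \<rhd> ?r) = ?R \<rhd> \<theta>"
      using arg_cong[OF \<epsilon>(2), of "\<lambda>z. ?R \<rhd> z"] ty \<epsilon>(1) by (simp add: in_hom1 in_hom2)
    have c: "(?R \<rhd> (\<theta> \<lhd> y A)) \<bullet> (?R \<rhd> ?l) = id2 C (?R \<cdot> (?Y \<cdot> y A))"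
      using arg_cong[OF \<theta>(2), of "\<lambda>z. ?R \<rhd> z"] ty \<theta>(1) by (simp add: in_hom1 in_hom2)
    have RY: "?R \<cdot> ?Y \<in> hom1 C (P A) (P A)" using ty by (simp add: in_hom1)
    have "((?R \<rhd> \<theta>) \<bullet> \<eta>) \<lhd> y A = ?r \<lhd> y A"
      using ty \<theta>(1) \<eta> by (simp add: in_hom1 in_hom2 vcomp_reassoc[OF c])
    then have d: "(?R \<rhd> \<theta>) \<bullet> \<eta> = ?r"
      by (rule inj_onD[OF bij_betw_imp_inj_on[OF extends_restriction_bij[OF id_ext yA id RY]]])
        (use ty \<theta>(1) \<eta>(1) in \<open>simp_all add: in_hom1 in_hom2\<close>)
    show "(((?R \<rhd> \<epsilon>) \<bullet> (\<eta> \<lhd> ?R)) \<lhd> ?Y) \<bullet> ?r = ?r"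
      using ty \<eta>(1) \<epsilon>(1) \<theta>(1) by (simp add: in_hom1 in_hom2 a vcomp_reassoc[OF b] d)
  qed
  show ?thesis
    using that[OF adjunctionI[OF L(1) R(1) \<eta>(1) \<epsilon>(1) t1 t2]] .
qed

lemma admissible_unit:
  assumes "A \<in> objs C"
  shows "admissible C K (y A)"
  using kz_map_unit_adjunction[OF assms] admissibleI assms by (metis y_cells(2))

lemma left_extension_res:
  assumes "adjunction C (kz_map C K L) R \<eta> \<epsilon>" "L \<in> hom1 C A B"
    "extends_restriction (y A) Q" "Q \<in> hom1 C (P A) Z"
  shows "left_extension C (Q \<cdot> y A) (y B \<cdot> L) (Q \<cdot> R)
    (Q \<rhd> ((R \<rhd> inv2 C (kz_map_cell C K L)) \<bullet> (\<eta> \<lhd> y A)))"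
proof -
  have "A \<in> objs C" using assms(2) by (auto simp: in_hom1)
  then show ?thesis
    using left_extension_right_adjoint[OF assms(3,1) kz_map_extension(4,3)[OF assms(2)] y_hom assms(4)
        kz_map_extension(1)[OF assms(2)]] by blast
qed

text \<open>
  This is \<open>left_extension_res\<close> for the identity of \<open>P A\<close>, which extends its restriction because it is
  the chosen extension of \<open>y A\<close>.
\<close>

lemma left_extension_res_unit:
  assumes "adjunction C (kz_map C K L) R \<eta> \<epsilon>" "L \<in> hom1 C A B"
  shows "left_extension C (y A) (y B \<cdot> L) R ((R \<rhd> inv2 C (kz_map_cell C K L)) \<bullet> (\<eta> \<lhd> y A))"
proof -
  have A: "A \<in> objs C" "B \<in> objs C" using assms(2) by (auto simp: in_hom1)
  note h = kz_map_extension[OF assms(2)]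
  obtain R: "R \<in> hom1 C (P B) (P A)" "\<eta> \<in> hom2 C (id1 C (P A)) (R \<cdot> kz_map C K L)"
    using adjunctionE[OF assms(1) h(1)] by blast
  show ?thesis
    using left_extension_res[OF assms id_extends_restriction[OF A(1)] id1_hom] A R h(1)
      inv2(1)[OF h(4,3)] assms(2) by (simp add: in_hom1 in_hom2)
qed

text \<open>
  The right adjoint \<open>R\<close> is compared with the chosen extension of its restriction by means of the two
  universal properties; the resulting 2-cells \<open>\<kappa>\<close> and \<open>\<mu>\<close> turn out to be mutually inverse.
\<close>

lemma res_extends_restriction:
  assumes "adjunction C (kz_map C K L) R \<eta> \<epsilon>" "L \<in> hom1 C A B"
  shows "extends_restriction (y B) R"
proof -
  have ob: "A \<in> objs C" "B \<in> objs C" using assms(2) by (auto simp: in_hom1)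
  note h = kz_map_extension[OF assms(2)]
  obtain R: "R \<in> hom1 C (P B) (P A)" "\<eta> \<in> hom2 C (id1 C (P A)) (R \<cdot> kz_map C K L)"
    using adjunctionE[OF assms(1) h(1)] by blast
  let ?\<phi> = "(R \<rhd> inv2 C (kz_map_cell C K L)) \<bullet> (\<eta> \<lhd> y A)"
  note R_ext = left_extension_res_unit[OF assms]
  note yA = y_hom[OF ob(1)] and yB = y_hom[OF ob(2)]
  have yL: "y B \<cdot> L \<in> hom1 C A (P B)" using assms ob by (simp add: in_hom1)
  note \<phi> = left_extensionD(2)[OF R_ext yA yL]
  have Ry: "R \<cdot> y B \<in> hom1 C B (P A)" using R ob by (simp add: in_hom1)
  let ?S = "kz_lan K B A (R \<cdot> y B)" and ?c = "kz_lan_cell K B A (R \<cdot> y B)"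
  note S = lan_hom[OF ob(2,1) Ry] and S_ext = ext_left_extension[OF ob(2,1) Ry]
  note i = inv2[OF cell_iso[OF ob(2,1) Ry] S(2)]
  note ty = R S i(1) ob assms(2) yL Ry
  obtain \<kappa> where \<kappa>: "\<kappa> \<in> hom2 C ?S R" "(\<kappa> \<lhd> y B) \<bullet> ?c = id2 C (R \<cdot> y B)"
    using left_extension_factor[OF S_ext Ry yB R(1), of "id2 C (R \<cdot> y B)"] ty
    by (auto simp: in_hom1 in_hom2)
  obtain \<mu> where \<mu>: "\<mu> \<in> hom2 C R ?S" "(\<mu> \<lhd> (y B \<cdot> L)) \<bullet> ?\<phi> = (?c \<lhd> L) \<bullet> ?\<phi>"
    using left_extension_factor[OF R_ext yA yL S(1), of "(?c \<lhd> L) \<bullet> ?\<phi>"] ty \<phi>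
    by (auto simp: in_hom1 in_hom2)
  have \<kappa>\<mu>: "\<kappa> \<bullet> \<mu> = id2 C R"
  proof (rule left_extension_endo_id[OF R_ext yA yL])
    show "\<kappa> \<bullet> \<mu> \<in> hom2 C R R" using ty \<kappa> \<mu> by (simp add: in_hom2)
    have a: "(\<kappa> \<lhd> (y B \<cdot> L)) \<bullet> (?c \<lhd> L) = id2 C (R \<cdot> (y B \<cdot> L))"
      using arg_cong[OF \<kappa>(2), of "\<lambda>z. z \<lhd> L"] ty \<kappa>(1) by (simp add: in_hom1 in_hom2)
    have "((\<kappa> \<bullet> \<mu>) \<lhd> (y B \<cdot> L)) \<bullet> ?\<phi> = (\<kappa> \<lhd> (y B \<cdot> L)) \<bullet> ((\<mu> \<lhd> (y B \<cdot> L)) \<bullet> ?\<phi>)"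
      using \<kappa>(1) \<mu>(1) ty vcomp_assoc'[of ?\<phi> "\<mu> \<lhd> (y B \<cdot> L)" "\<kappa> \<lhd> (y B \<cdot> L)"] \<phi>
      by (simp add: in_hom1 in_hom2 del: vcomp_assoc')
    also have "\<dots> = (\<kappa> \<lhd> (y B \<cdot> L)) \<bullet> ((?c \<lhd> L) \<bullet> ?\<phi>)" by (simp only: \<mu>(2))
    also have "\<dots> = id2 C (R \<cdot> (y B \<cdot> L)) \<bullet> ?\<phi>"
      by (rule vcomp_reassoc[OF a]) (use \<kappa>(1) ty \<phi> in \<open>auto simp: in_hom1 in_hom2\<close>)
    also have "\<dots> = ?\<phi>" using \<phi> by (simp add: in_hom2)
    finally show "((\<kappa> \<bullet> \<mu>) \<lhd> (y B \<cdot> L)) \<bullet> ?\<phi> = ?\<phi>" .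
  qed
  \<comment> \<open>On \<open>B\<close> the 2-cell \<open>\<kappa>\<close> is the inverse of the invertible \<open>?c\<close>, so its right inverse \<open>\<mu>\<close> must be \<open>?c\<close>.\<close>
  have "(\<kappa> \<lhd> y B) \<bullet> (\<mu> \<lhd> y B) = id2 C (R \<cdot> y B)"
    using arg_cong[OF \<kappa>\<mu>, of "\<lambda>z. z \<lhd> y B"] ty \<kappa>(1) \<mu>(1) by (simp add: in_hom1 in_hom2)
  moreover have "\<kappa> \<lhd> y B = inv2 C ?c"
  proof -
    have "\<kappa> \<lhd> y B = ((\<kappa> \<lhd> y B) \<bullet> ?c) \<bullet> inv2 C ?c"
      using ty \<kappa>(1) i by (simp add: in_hom1 in_hom2)
    then show ?thesis using ty \<kappa>(2) by (simp add: in_hom2)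
  qed
  ultimately have "?c \<bullet> (inv2 C ?c \<bullet> (\<mu> \<lhd> y B)) = ?c \<bullet> id2 C (R \<cdot> y B)" by simp
  then have \<mu>y: "\<mu> \<lhd> y B = ?c"
    using ty \<mu>(1) by (simp add: in_hom1 in_hom2 vcomp_reassoc[OF i(3)])
  have "\<mu> \<bullet> \<kappa> = id2 C ?S"
  proof (rule left_extension_endo_id[OF S_ext Ry yB])
    show "\<mu> \<bullet> \<kappa> \<in> hom2 C ?S ?S" using \<kappa> \<mu> by (simp add: in_hom2)
    show "((\<mu> \<bullet> \<kappa>) \<lhd> y B) \<bullet> ?c = ?c" using \<kappa> \<mu> ty by (simp add: in_hom1 in_hom2 \<mu>y)
  qed
  then have "iso2 C \<kappa>" using iso2I[OF \<kappa>(1) \<mu>(1)] \<kappa>\<mu> by simp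
  then show ?thesis
    using extends_restriction_iso[OF lan_extends_restriction[OF ob(2,1) Ry] _ \<kappa>(1) yB S(1)] by simp
qed

text \<open>
  Both \<open>Q\<close> and \<open>R\<close> extend their restrictions, hence so does \<open>Q \<cdot> R\<close>. It is a left extension along
  \<open>y B \<cdot> L\<close>, and therefore it restricts to one along \<open>L\<close>.
\<close>

lemma left_extension_yoneda_cell:
  assumes "adjunction C (kz_map C K L) R \<eta> \<epsilon>" "L \<in> hom1 C A B"
    "extends_restriction (y A) Q" "Q \<in> hom1 C (P A) (P E)" "E \<in> objs C"
  shows "left_extension C (Q \<cdot> y A) L (Q \<cdot> (R \<cdot> y B))
    (Q \<rhd> ((R \<rhd> inv2 C (kz_map_cell C K L)) \<bullet> (\<eta> \<lhd> y A)))"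
proof -
  have ob: "A \<in> objs C" "B \<in> objs C" using assms(2) by (auto simp: in_hom1)
  obtain R: "R \<in> hom1 C (P B) (P A)"
    using adjunctionE[OF assms(1) kz_map_extension(1)[OF assms(2)]] by blast
  have "left_extension C (Q \<cdot> y A) L ((Q \<cdot> R) \<cdot> y B)
    (Q \<rhd> ((R \<rhd> inv2 C (kz_map_cell C K L)) \<bullet> (\<eta> \<lhd> y A)))"
    by (rule left_extension_restrict_unit[OF
        extends_restriction_comp[OF res_extends_restriction[OF assms(1,2)] assms(3) ob(2,1) assms(5) R assms(4)]
        left_extension_res[OF assms(1-4)] assms(2) _ assms(5)])
      (use assms(4) R ob in \<open>simp_all add: in_hom1\<close>)
  then show ?thesis using assms(4) R ob by (simp add: in_hom1)
qed

end

theorem theorem18: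
  fixes C :: "('o, 'm, 'c) two_cat" (structure)
    and K :: "('o, 'm, 'c) kz"
    and res :: "'m \<Rightarrow> 'm"
    and \<eta> :: "'m \<Rightarrow> 'c"
  assumes "locally_fully_faithful_kz_doctrine C K"
    and "\<And>L. admissible C K L \<Longrightarrow> right_adjoint_unit C (kz_map C K L) (res L) (\<eta> L)"
  shows
    "(\<forall>L M. admissible C K L \<and> admissible C K M \<and> tgt1 C L = src1 C M
        \<longrightarrow> admissible C K (M \<cdot> L))
   \<and> (\<forall>A. admissible_obj C K A \<longrightarrow> admissible C K (kz_y K A))
   \<and> (\<forall>A B L. L \<in> hom1 C A B \<and> admissible C K L \<and> admissible_obj C K A
        \<longrightarrow> absolute_left_lifting C (kz_y K A) (yoneda_R C K res L) L (yoneda_cell C K res \<eta> L)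
          \<and> left_extension C (kz_y K A) L (yoneda_R C K res L) (yoneda_cell C K res \<eta> L))
   \<and> (\<forall>A. admissible_obj C K A
        \<longrightarrow> left_extension C (kz_y K A) (kz_y K A) (id1 C (kz_P K A)) (id2 C (kz_y K A)))
   \<and> (\<forall>A B D L M. admissible_obj C K A \<and> admissible_obj C K B
          \<and> L \<in> hom1 C A B \<and> admissible C K L \<and> M \<in> hom1 C B D \<and> admissible C K M
        \<longrightarrow> left_extension C (kz_y K A) (M \<cdot> L)
              (yoneda_R C K res (kz_y K B \<cdot> L) \<cdot> yoneda_R C K res M)
              ((yoneda_R C K res (kz_y K B \<cdot> L) \<rhd> (yoneda_cell C K res \<eta> M \<lhd> L))
                \<bullet> yoneda_cell C K res \<eta> (kz_y K B \<cdot> L)))"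
proof (intro conjI)
  interpret locally_fully_faithful_kz_doctrine C K by fact
  have res: "\<exists>\<epsilon>. adjunction C (kz_map C K L) (res L) (\<eta> L) \<epsilon>" if "admissible C K L" for L
    using assms(2)[OF that] by (simp add: right_adjoint_unit_def)
  have res_hom: "res L \<in> hom1 C (P B) (P A)" "yoneda_R C K res L = res L \<cdot> y B"
    "yoneda_R C K res L \<in> hom1 C B (P A)"
    "yoneda_cell C K res \<eta> L = (res L \<rhd> inv2 C (kz_map_cell C K L)) \<bullet> (\<eta> L \<lhd> y A)"
    if "admissible C K L" "L \<in> hom1 C A B" for A B L
  proof -
    show 1: "res L \<in> hom1 C (P B) (P A)"
      using res[OF that(1)] adjunctionE[OF _ kz_map_extension(1)[OF that(2)]] by blast
    show "yoneda_R C K res L = res L \<cdot> y B"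
      "yoneda_cell C K res \<eta> L = (res L \<rhd> inv2 C (kz_map_cell C K L)) \<bullet> (\<eta> L \<lhd> y A)"
      using that(2) by (simp_all add: yoneda_R_def yoneda_cell_def in_hom1)
    then show "yoneda_R C K res L \<in> hom1 C B (P A)"
      using 1 that(2) by (auto simp: in_hom1)
  qed
  have ob: "A \<in> objs C" if "admissible_obj C K A" for A
    using that by (simp add: admissible_obj_def)
  show comp: "\<forall>L M. admissible C K L \<and> admissible C K M \<and> tgt1 C L = src1 C M \<longrightarrow> admissible C K (M \<cdot> L)"
    using admissible_comp hom1_self by (auto simp: admissible_def in_hom1)
  show unit: "\<forall>A. admissible_obj C K A \<longrightarrow> admissible C K (y A)"
    using admissible_unit ob by blast
  have ext: "left_extension C (y A) L (yoneda_R C K res L) (yoneda_cell C K res \<eta> L)"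
    if L: "L \<in> hom1 C A B" "admissible C K L" for A B L
  proof -
    have A: "A \<in> objs C" "B \<in> objs C" using L by (auto simp: in_hom1)
    obtain \<epsilon> where adj: "adjunction C (kz_map C K L) (res L) (\<eta> L) \<epsilon>" using res[OF L(2)] ..
    show ?thesis
      unfolding res_hom(2,4)[OF L(2,1)]
      by (rule left_extension_restrict_unit[OF res_extends_restriction[OF adj L(1)]
            left_extension_res_unit[OF adj L(1)] L(1) y_hom[OF A(1)] A(1) res_hom(1)[OF L(2,1)]])
  qed
  have lift: "absolute_left_lifting C (y A) (yoneda_R C K res L) L (yoneda_cell C K res \<eta> L)"
    if L: "L \<in> hom1 C A B" "admissible C K L" for A B L
  proof -
    have A: "A \<in> objs C" "B \<in> objs C" using L by (auto simp: in_hom1)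
    obtain \<epsilon> where adj: "adjunction C (kz_map C K L) (res L) (\<eta> L) \<epsilon>" using res[OF L(2)] ..
    have *: "left_lifting C (y A \<cdot> G) (yoneda_R C K res L) (L \<cdot> G) (yoneda_cell C K res \<eta> L \<lhd> G)"
      if "G \<in> hom1 C X A" for G X
      unfolding res_hom(2,4)[OF L(2,1)]
      by (rule left_lifting_right_adjoint[OF y_fully_faithful[OF A(2)] adj kz_map_extension(4,3)[OF L(1)]
            y_hom[OF A(1)] L(1) y_hom[OF A(2)] kz_map_extension(1)[OF L(1)] that])
    have "yoneda_cell C K res \<eta> L \<in> hom2 C (y A) (yoneda_R C K res L \<cdot> L)"
      using left_extensionD(2)[OF ext[OF L] y_hom[OF A(1)] L(1)] .
    then show ?thesis
      using *[of "id1 C A" A] * A L(1) by (simp add: absolute_left_lifting_def in_hom1 in_hom2)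
  qed
  show "\<forall>A B L. L \<in> hom1 C A B \<and> admissible C K L \<and> admissible_obj C K A
        \<longrightarrow> absolute_left_lifting C (y A) (yoneda_R C K res L) L (yoneda_cell C K res \<eta> L)
          \<and> left_extension C (y A) L (yoneda_R C K res L) (yoneda_cell C K res \<eta> L)"
    using ext lift by blast
  show "\<forall>A. admissible_obj C K A \<longrightarrow> left_extension C (y A) (y A) (id1 C (P A)) (id2 C (y A))"
    using id_extends_restriction ob by (auto simp: extends_restriction_def)
  show "\<forall>A B D L M. admissible_obj C K A \<and> admissible_obj C K B
          \<and> L \<in> hom1 C A B \<and> admissible C K L \<and> M \<in> hom1 C B D \<and> admissible C K M
        \<longrightarrow> left_extension C (y A) (M \<cdot> L) (yoneda_R C K res (y B \<cdot> L) \<cdot> yoneda_R C K res M)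
              ((yoneda_R C K res (y B \<cdot> L) \<rhd> (yoneda_cell C K res \<eta> M \<lhd> L)) \<bullet> yoneda_cell C K res \<eta> (y B \<cdot> L))"
  proof (intro allI impI, elim conjE)
    fix A B D L M
    assume A: "admissible_obj C K A" "admissible_obj C K B"
      and L: "L \<in> hom1 C A B" "admissible C K L" and M: "M \<in> hom1 C B D" "admissible C K M"
    note AB = ob[OF A(1)] ob[OF A(2)] 
    note yA = y_hom[OF AB(1)]
    have yL: "y B \<cdot> L \<in> hom1 C A (P B)" using L AB by (simp add: in_hom1)
    have yLa: "admissible C K (y B \<cdot> L)"
      using admissible_comp[OF L(2) admissible_unit[OF AB(2)] L(1) y_hom[OF AB(2)]] .
    let ?Q = "yoneda_R C K res (y B \<cdot> L)" and ?\<psi> = "yoneda_cell C K res \<eta> (y B \<cdot> L)"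
      and ?\<phi> = "yoneda_cell C K res \<eta> M"
    note Q = res_hom(3)[OF yLa yL] and Q_ext = ext[OF yL yLa]
    obtain \<epsilon> where adjL: "adjunction C (kz_map C K L) (res L) (\<eta> L) \<epsilon>" using res[OF L(2)] ..
    obtain \<epsilon>' where adjM: "adjunction C (kz_map C K M) (res M) (\<eta> M) \<epsilon>'" using res[OF M(2)] ..
    \<comment> \<open>\<open>res L\<close> has the same universal property as \<open>?Q\<close>, even before restriction to \<open>B\<close>.\<close>
    obtain \<alpha> where \<alpha>: "\<alpha> \<in> hom2 C (res L) ?Q" "iso2 C \<alpha>"
      using left_extension_unique[OF left_extension_res_unit[OF adjL L(1)] Q_ext yA yL] by blast
    have Q_hom: "extends_restriction (y B) ?Q"
      by (rule extends_restriction_iso[OF res_extends_restriction[OF adjL L(1)] \<alpha>(2,1)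
            y_hom[OF AB(2)] res_hom(1)[OF L(2,1)]])
    have 1: "left_extension C (y A) L (?Q \<cdot> y B) ?\<psi>"
      by (rule left_extension_restrict_unit[OF Q_hom Q_ext L(1) yA AB(1) Q])
    have 2: "left_extension C (?Q \<cdot> y B) M (?Q \<cdot> yoneda_R C K res M) (?Q \<rhd> ?\<phi>)"
      unfolding res_hom(2,4)[OF M(2,1)]
      by (rule left_extension_yoneda_cell[OF adjM M(1) Q_hom Q AB(1)])
    have "?\<phi> \<in> hom2 C (y B) (yoneda_R C K res M \<cdot> M)"
      using left_extensionD(2)[OF ext[OF M] y_hom[OF AB(2)] M(1)] .
    then have "(?Q \<rhd> ?\<phi>) \<lhd> L = ?Q \<rhd> (?\<phi> \<lhd> L)"
      using Q L(1) AB by (simp add: in_hom1 in_hom2)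
    then show "left_extension C (y A) (M \<cdot> L) (?Q \<cdot> yoneda_R C K res M) ((?Q \<rhd> (?\<phi> \<lhd> L)) \<bullet> ?\<psi>)"
      using left_extension_paste[OF 1 2 yA L(1) M(1)] by simp
  qed
qed

end
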